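(* Let $(M^{2m+1},H,J,\theta)$ be a pseudo-Hermitian manifold. Assume that there exist a non-negative $C^2$ function $\gamma$ on $M$, positive constants $A,B$, and a smooth function $G$ on $[0,+\infty)$ such that: for all $\eta>0$ there is a compact set $K_\eta\subset M$ with $\gamma(x)>\eta$ whenever $x\notin K_\eta$; $|\nabla\gamma|\leq A\gamma^{\frac12}$ outside some compact subset of $M$; $\Delta_b\gamma\leq B\gamma^{\frac12}G(\gamma^{\frac12})^{\frac12}$ outside some compact subset of $M$; and $G(0)>0$, $G'\geq0$, $G^{-\frac12}\notin L^1(+\infty)$, $\limsup_{t\to+\infty}\frac{tG(t^{\frac12})}{G(t)}<+\infty$. Assume that $u$ is a $C^2$ function on $M$ satisfying $$\Delta_bu\geq\phi(u,|\nabla^Lu|,|\nabla^Hu|),$$ where $\phi(t,x_1,x_2)$ is $C^0$ in $t$, $C^2$ in $(x_1,x_2)$, and such that $(\mathrm{Hess}_{x_1,x_2}\phi)(t,x_1,x_2)\geq0$. Set $f(t)=\phi(t,0,0)$. Let $F$ be a continuous function which is positive on some interval $[a,+\infty)$ and satisfies $$\int_b^\infty\left\{\int_a^tF(s)ds\right\}^{-\frac12}dt<+\infty\ \text{ for some } b>a,$$ $$\limsup_{t\to+\infty}\frac{\int_a^tF(s)ds}{tF(t)}<+\infty,$$ $$\liminf_{t\to+\infty}\frac{\left\{\int_a^tF(s)ds\right\}^{\frac12}}{F(t)}\frac{\partial\phi}{\partial x_i}(t,0,0)>-\infty,\quad i=1,2.$$ (1) If $\liminf_{t\to+\infty}\frac{f(t)}{F(t)}>0$,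 then $u$ is bounded above on $M$ and $f(\sup_Mu)\leq0$. (2) If $\liminf_{t\to+\infty}\frac{f(t)}{F(t)}\leq0$, then either $\sup_Mu=+\infty$, or $u$ is bounded above on $M$ and $f(\sup_Mu)\leq0$.
   Context: Pseudo-Hermitian manifolds: $M$ is a connected, second countable, orientable smooth real manifold of dimension $2m+1$ with a complex rank-$m$ subbundle $T_{1,0}M\subset TM\otimes\mathbb{C}$ such that, with $T_{0,1}M=\overline{T_{1,0}M}$, $T_{1,0}M\cap T_{0,1}M=\{0\}$ and $[\Gamma(T_{1,0}M),\Gamma(T_{1,0}M)]\subseteq\Gamma(T_{1,0}M)$. $H=\mathrm{Re}\{T_{1,0}M\oplus T_{0,1}M\}$ is the Levi distribution, with complex structure $J(X+\overline X)=\sqrt{-1}(X-\overline X)$ for $X\in T_{1,0}M$. $\theta$ is a global nowhere vanishing real 1-form with $\ker\theta=H$ whose Levi form $L_\theta(X,Y)=d\theta(X,JY)$, $X,Y\in H$, is positive definite. The exterior derivative is normalized by $d\theta(X,Y)=\frac12\big(X\theta(Y)-Y\theta(X)-\theta([X,Y])\big)$. The Reeb field $\xi$ is the unique vector field with $\theta(\xi)=1$, $d\theta(\xi,\cdot)=0$; $TM=H\oplus L$ with $L=\mathbb{R}\xi$ and projections $\pi_H:TM\to H$, $\pi_L:TM\to L$; $J$ is extended by $J\xi=0$. The Webster metric is $g_\theta(X,Y)=L_\theta(\pi_HX,\pi_HY)+\theta(X)\theta(Y)$, with norm $|\cdot|$. The Tanaka-Webster connection $\nabla$ is the unique linear connection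 with: $\nabla_X\Gamma(H)\subset\Gamma(H)$ for all $X$; $\nabla J=0$, $\nabla g_\theta=0$; and torsion satisfying $T_\nabla(X,Y)=2d\theta(X,Y)\xi$ and $T_\nabla(\xi,JX)+JT_\nabla(\xi,X)=0$ for $X,Y\in H$. For a $C^2$ function $u$: $\nabla u$ is the gradient with respect to $g_\theta$, $\nabla^Hu=\pi_H(\nabla u)$, $\nabla^Lu=\pi_L(\nabla u)$; $(\nabla du)(Y,Z)=Y(Zu)-(\nabla_YZ)u$; the sub-Laplacian is $\Delta_bu=\mathrm{trace}_H(\nabla du)$ (trace over a $g_\theta$-orthonormal frame of $H$). $\phi$ is a real-valued function of $(t,x_1,x_2)\in\mathbb{R}\times\mathbb{R}\times\mathbb{R}$, and $\mathrm{Hess}_{x_1,x_2}\phi\ge0$ means that the $2\times2$ Hessian matrix in $(x_1,x_2)$ is positive semidefinite. $G^{-1/2}\notin L^1(+\infty)$ means that $G^{-1/2}$ is not integrable at $+\infty$. *)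

theory Defs
  imports "HOL-Analysis.Analysis"
begin

section \<open>Functions of class C^k\<close>

text \<open>Only meant for open sets of finite-dimensional spaces.\<close>

fun Ck_on :: "nat \<Rightarrow> ('v::real_normed_vector \<Rightarrow> 'w::real_normed_vector) \<Rightarrow> 'v set \<Rightarrow> bool" where
  "Ck_on 0 f S \<longleftrightarrow> continuous_on S f"
| "Ck_on (Suc k) f S \<longleftrightarrow>
     (\<forall>x\<in>S. f differentiable (at x)) \<and>
     (\<forall>v. Ck_on k (\<lambda>x. frechet_derivative f (at x) v) S)"

definition smooth_on :: "('v::real_normed_vector \<Rightarrow> 'w::real_normed_vector) \<Rightarrow> 'v set \<Rightarrow> bool" where
  "smooth_on f S \<longleftrightarrow> (\<forall>k. Ck_on k f S)"

text \<open>Smoothness on the closed half-line, with one-sided derivatives at 0.\<close>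

definition smooth_halfline :: "(real \<Rightarrow> real) \<Rightarrow> bool" where
  "smooth_halfline G \<longleftrightarrow>
     (\<exists>D :: nat \<Rightarrow> real \<Rightarrow> real. (\<forall>t\<ge>0. D 0 t = G t) \<and>
        (\<forall>k. \<forall>t\<ge>0. (D k has_real_derivative D (Suc k) t) (at t within {0..})))"

section \<open>Smooth manifolds\<close>

text \<open>
  The manifold is a type \<open>'a\<close>, a chart is a pair of its domain and its coordinate map.
  The tangent space at \<open>p\<close> is \<open>real^'n\<close>, a tangent vector being given by its
  components with respect to one fixed chart \<open>chart_at p\<close> around \<open>p\<close>;
  components in other charts are obtained from the derivatives of the coordinate changes.
  Accordingly, a vector field is a map \<open>'a \<Rightarrow> real^'n\<close>, and an element of the complexified
  tangent space at \<open>p\<close> is an element of \<open>complex^'n\<close>.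
\<close>

type_synonym ('a, 'n) chart = "'a set \<times> ('a \<Rightarrow> real^'n)"
type_synonym ('a, 'n) vfield = "'a \<Rightarrow> real^'n"
type_synonym ('a, 'n) cvfield = "'a \<Rightarrow> complex^'n"

definition cinv :: "('a, 'n) chart \<Rightarrow> real^'n \<Rightarrow> 'a" where
  "cinv c = inv_into (fst c) (snd c)"

definition is_chart :: "('a::topological_space, 'n::finite) chart \<Rightarrow> bool" where
  "is_chart c \<longleftrightarrow> open (fst c) \<and> open (snd c ` fst c) \<and>
     homeomorphism (fst c) (snd c ` fst c) (snd c) (cinv c)"

definition smooth_atlas :: "('a::topological_space, 'n::finite) chart set \<Rightarrow> bool" where
  "smooth_atlas At \<longleftrightarrow>
     (\<forall>c\<in>At. is_chart c) \<and> (\<Union>c\<in>At. fst c) = UNIV \<and>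
     (\<forall>c\<in>At. \<forall>d\<in>At. smooth_on (snd d \<circ> cinv c) (snd c ` (fst c \<inter> fst d)))"

definition orientable :: "('a::topological_space, 'n::finite) chart set \<Rightarrow> bool" where
  "orientable At \<longleftrightarrow>
     (\<exists>B. smooth_atlas B \<and> smooth_atlas (At \<union> B) \<and>
        (\<forall>c\<in>B. \<forall>d\<in>B. \<forall>p \<in> fst c \<inter> fst d.
           det (matrix (frechet_derivative (snd d \<circ> cinv c) (at (snd c p)))) > 0))"

context
  fixes At :: "('a::topological_space, 'n::finite) chart set"
begin

definition chart_at :: "'a \<Rightarrow> ('a, 'n) chart" where
  "chart_at p = (SOME c. c \<in> At \<and> p \<in> fst c)"

definition Ck_fun :: "nat \<Rightarrow> ('a \<Rightarrow> real) \<Rightarrow> 'a set \<Rightarrow> bool" where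
  "Ck_fun k f W \<longleftrightarrow> (\<forall>c\<in>At. Ck_on k (f \<circ> cinv c) (snd c ` (fst c \<inter> W)))"

definition smooth_fun :: "('a \<Rightarrow> real) \<Rightarrow> 'a set \<Rightarrow> bool" where
  "smooth_fun f W \<longleftrightarrow> (\<forall>k. Ck_fun k f W)"

definition differential :: "('a \<Rightarrow> real) \<Rightarrow> 'a \<Rightarrow> real^'n \<Rightarrow> real" where
  "differential f p v =
     frechet_derivative (f \<circ> cinv (chart_at p)) (at (snd (chart_at p) p)) v"

text \<open>Change of components of a tangent vector at \<open>q\<close> between the preferred chart at \<open>q\<close>
  and a chart \<open>c\<close> around \<open>q\<close>.\<close>

definition to_chart :: "('a, 'n) chart \<Rightarrow> 'a \<Rightarrow> real^'n \<Rightarrow> real^'n" where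
  "to_chart c q v =
     frechet_derivative (snd c \<circ> cinv (chart_at q)) (at (snd (chart_at q) q)) v"

definition from_chart :: "('a, 'n) chart \<Rightarrow> 'a \<Rightarrow> real^'n \<Rightarrow> real^'n" where
  "from_chart c q v = frechet_derivative (snd (chart_at q) \<circ> cinv c) (at (snd c q)) v"

definition vf_rep :: "('a, 'n) chart \<Rightarrow> ('a, 'n) vfield \<Rightarrow> real^'n \<Rightarrow> real^'n" where
  "vf_rep c X y = to_chart c (cinv c y) (X (cinv c y))"

definition smooth_vf :: "'a set \<Rightarrow> ('a, 'n) vfield \<Rightarrow> bool" where
  "smooth_vf W X \<longleftrightarrow> (\<forall>c\<in>At. smooth_on (vf_rep c X) (snd c ` (fst c \<inter> W)))"

definition vf_apply :: "('a, 'n) vfield \<Rightarrow> ('a \<Rightarrow> real) \<Rightarrow> 'a \<Rightarrow> real" where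
  "vf_apply X f p = differential f p (X p)"

definition lie_bracket :: "('a, 'n) vfield \<Rightarrow> ('a, 'n) vfield \<Rightarrow> ('a, 'n) vfield" where
  "lie_bracket X Y p =
     (let c = chart_at p; y = snd c p in
        frechet_derivative (vf_rep c Y) (at y) (X p) - frechet_derivative (vf_rep c X) (at y) (Y p))"

text \<open>The vector field near \<open>p\<close> with constant components \<open>v\<close> in the chart \<open>chart_at p\<close>; it
  extends the tangent vector \<open>v\<close> at \<open>p\<close> and serves to evaluate tensorial expressions,
  given by formulas for vector fields, on individual tangent vectors.\<close>

definition coord_field :: "'a \<Rightarrow> real^'n \<Rightarrow> ('a, 'n) vfield" where
  "coord_field p v q = from_chart (chart_at p) q v"

definition smooth_one_form :: "('a \<Rightarrow> real^'n \<Rightarrow> real) \<Rightarrow> bool" where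
  "smooth_one_form \<theta> \<longleftrightarrow> (\<forall>p. linear (\<theta> p)) \<and>
     (\<forall>c\<in>At. \<forall>v. smooth_on (\<lambda>y. \<theta> (cinv c y) (from_chart c (cinv c y) v)) (snd c ` fst c))"

text \<open>Exterior derivative with the normalizing factor 1/2.\<close>

definition ext_deriv ::
    "('a \<Rightarrow> real^'n \<Rightarrow> real) \<Rightarrow> ('a, 'n) vfield \<Rightarrow> ('a, 'n) vfield \<Rightarrow> 'a \<Rightarrow> real" where
  "ext_deriv \<theta> X Y p =
     (vf_apply X (\<lambda>q. \<theta> q (Y q)) p - vf_apply Y (\<lambda>q. \<theta> q (X q)) p - \<theta> p (lie_bracket X Y p)) / 2"

definition dform :: "('a \<Rightarrow> real^'n \<Rightarrow> real) \<Rightarrow> 'a \<Rightarrow> real^'n \<Rightarrow> real^'n \<Rightarrow> real" where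
  "dform \<theta> p v w = ext_deriv \<theta> (coord_field p v) (coord_field p w) p"

end

definition re_vec :: "complex^'n \<Rightarrow> real^'n::finite" where
  "re_vec Z = (\<chi> i. Re (Z $ i))"

definition im_vec :: "complex^'n \<Rightarrow> real^'n::finite" where
  "im_vec Z = (\<chi> i. Im (Z $ i))"

definition of_real_vec :: "real^'n \<Rightarrow> complex^'n::finite" where
  "of_real_vec v = (\<chi> i. complex_of_real (v $ i))"

definition cnj_vec :: "complex^'n \<Rightarrow> complex^'n::finite" where
  "cnj_vec Z = (\<chi> i. cnj (Z $ i))"

text \<open>Complex-bilinear extension of the Lie bracket.\<close>

definition clie_bracket ::
    "('a::topological_space, 'n::finite) chart set \<Rightarrow> ('a, 'n) cvfield \<Rightarrow> ('a, 'n) cvfield \<Rightarrow> ('a, 'n) cvfield"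
  where
  "clie_bracket At Z W p =
     (let X = (\<lambda>q. re_vec (Z q)); Y = (\<lambda>q. im_vec (Z q));
          X' = (\<lambda>q. re_vec (W q)); Y' = (\<lambda>q. im_vec (W q)) in
        of_real_vec (lie_bracket At X X' p - lie_bracket At Y Y' p) +
        \<i> *s of_real_vec (lie_bracket At X Y' p + lie_bracket At Y X' p))"

definition smooth_cvf ::
    "('a::topological_space, 'n::finite) chart set \<Rightarrow> 'a set \<Rightarrow> ('a, 'n) cvfield \<Rightarrow> bool" where
  "smooth_cvf At W Z \<longleftrightarrow> smooth_vf At W (\<lambda>q. re_vec (Z q)) \<and> smooth_vf At W (\<lambda>q. im_vec (Z q))"

section \<open>Pseudo-Hermitian manifolds\<close>

definition complex_subbundle ::
    "nat \<Rightarrow> ('a::topological_space, 'n::finite) chart set \<Rightarrow> ('a \<Rightarrow> (complex^'n) set) \<Rightarrow> bool" where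
  "complex_subbundle m At E \<longleftrightarrow>
     (\<forall>p. vec.subspace (E p) \<and> vec.dim (E p) = m) \<and>
     (\<forall>p. \<exists>U Z. open U \<and> p \<in> U \<and> (\<forall>i<m. smooth_cvf At U (Z i)) \<and>
        (\<forall>q\<in>U. E q = vec.span ((\<lambda>i. Z i q) ` {..<m})))"

text \<open>Here and below, sections are local ones, over arbitrary open sets.\<close>

definition involutive ::
    "('a::topological_space, 'n::finite) chart set \<Rightarrow> ('a \<Rightarrow> (complex^'n) set) \<Rightarrow> bool" where
  "involutive At E \<longleftrightarrow>
     (\<forall>U Z W. open U \<and> smooth_cvf At U Z \<and> smooth_cvf At U W \<and> (\<forall>q\<in>U. Z q \<in> E q \<and> W q \<in> E q)
        \<longrightarrow> (\<forall>q\<in>U. clie_bracket At Z W q \<in> E q))"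

definition levi_dist :: "('a \<Rightarrow> (complex^'n) set) \<Rightarrow> 'a \<Rightarrow> (real^'n::finite) set" where
  "levi_dist T10 p = {re_vec (Z + W) | Z W. Z \<in> T10 p \<and> W \<in> cnj_vec ` T10 p}"

text \<open>\<open>J (X + cnj X) = \<i> (X - cnj X)\<close> for \<open>X \<in> T10\<close>, as an endomorphism of \<open>levi_dist\<close>.\<close>

definition JH :: "('a \<Rightarrow> (complex^'n) set) \<Rightarrow> 'a \<Rightarrow> real^'n \<Rightarrow> real^'n::finite" where
  "JH T10 p v = (THE w. \<exists>X \<in> T10 p. of_real_vec v = X + cnj_vec X \<and>
                                   of_real_vec w = \<i> *s (X - cnj_vec X))"

context
  fixes At :: "('a::topological_space, 'n::finite) chart set"
    and T10 :: "'a \<Rightarrow> (complex^'n) set"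
    and \<theta> :: "'a \<Rightarrow> real^'n \<Rightarrow> real"
begin

definition levi_form :: "'a \<Rightarrow> real^'n \<Rightarrow> real^'n \<Rightarrow> real" where
  "levi_form p v w = dform At \<theta> p v (JH T10 p w)"

definition pseudo_hermitian_manifold :: "nat \<Rightarrow> bool" where
  "pseudo_hermitian_manifold m \<longleftrightarrow>
     CARD('n) = 2 * m + 1 \<and>
     connected (UNIV :: 'a set) \<and> smooth_atlas At \<and> orientable At \<and>
     complex_subbundle m At T10 \<and> involutive At T10 \<and>
     (\<forall>p. T10 p \<inter> cnj_vec ` T10 p = {0}) \<and>
     smooth_one_form At \<theta> \<and>
     (\<forall>p. \<exists>v. \<theta> p v \<noteq> 0) \<and>
     (\<forall>p. {v. \<theta> p v = 0} = levi_dist T10 p) \<and>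
     (\<forall>p. \<forall>v \<in> levi_dist T10 p. v \<noteq> 0 \<longrightarrow> levi_form p v v > 0)"

definition reeb :: "('a, 'n) vfield" where
  "reeb p = (THE v. \<theta> p v = 1 \<and> (\<forall>w. dform At \<theta> p v w = 0))"

definition piL :: "'a \<Rightarrow> real^'n \<Rightarrow> real^'n" where
  "piL p v = \<theta> p v *\<^sub>R reeb p"

definition piH :: "'a \<Rightarrow> real^'n \<Rightarrow> real^'n" where
  "piH p v = v - piL p v"

definition J :: "'a \<Rightarrow> real^'n \<Rightarrow> real^'n" where
  "J p v = JH T10 p (piH p v)"

definition webster_metric :: "'a \<Rightarrow> real^'n \<Rightarrow> real^'n \<Rightarrow> real" where
  "webster_metric p v w = levi_form p (piH p v) (piH p w) + \<theta> p v * \<theta> p w"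

definition webster_norm :: "'a \<Rightarrow> real^'n \<Rightarrow> real" where
  "webster_norm p v = sqrt (webster_metric p v v)"

definition gradient :: "('a \<Rightarrow> real) \<Rightarrow> ('a, 'n) vfield" where
  "gradient f p = (THE w. \<forall>v. webster_metric p w v = differential At f p v)"

definition gradientH :: "('a \<Rightarrow> real) \<Rightarrow> ('a, 'n) vfield" where
  "gradientH f p = piH p (gradient f p)"

definition gradientL :: "('a \<Rightarrow> real) \<Rightarrow> ('a, 'n) vfield" where
  "gradientL f p = piL p (gradient f p)"

end

section \<open>The Tanaka-Webster connection\<close>

text \<open>\<open>nabla p v Y\<close> is the covariant derivative at \<open>p\<close>, in the direction \<open>v\<close>, of a vector field
  \<open>Y\<close> that is smooth near \<open>p\<close>; it is unconstrained if \<open>Y\<close> is not smooth near \<open>p\<close>.\<close>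

type_synonym ('a, 'n) connection = "'a \<Rightarrow> real^'n \<Rightarrow> ('a, 'n) vfield \<Rightarrow> real^'n"

context
  fixes At :: "('a::topological_space, 'n::finite) chart set"
    and nabla :: "('a, 'n) connection"
begin

definition linear_connection :: bool where
  "linear_connection \<longleftrightarrow>
     (\<forall>W. open W \<longrightarrow>
        (\<forall>p\<in>W. \<forall>Y. smooth_vf At W Y \<longrightarrow> linear (\<lambda>v. nabla p v Y)) \<and>
        (\<forall>p\<in>W. \<forall>v Y Z. smooth_vf At W Y \<and> smooth_vf At W Z \<longrightarrow>
           nabla p v (\<lambda>q. Y q + Z q) = nabla p v Y + nabla p v Z) \<and>
        (\<forall>p\<in>W. \<forall>v f Y. smooth_fun At f W \<and> smooth_vf At W Y \<longrightarrow>
           nabla p v (\<lambda>q. f q *\<^sub>R Y q) = differential At f p v *\<^sub>R Y p + f p *\<^sub>R nabla p v Y) \<and>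
        (\<forall>X Y. smooth_vf At W X \<and> smooth_vf At W Y \<longrightarrow> smooth_vf At W (\<lambda>q. nabla q (X q) Y)))"

definition torsion :: "('a, 'n) vfield \<Rightarrow> ('a, 'n) vfield \<Rightarrow> ('a, 'n) vfield" where
  "torsion X Y p = nabla p (X p) Y - nabla p (Y p) X - lie_bracket At X Y p"

definition nabla_du :: "('a \<Rightarrow> real) \<Rightarrow> ('a, 'n) vfield \<Rightarrow> ('a, 'n) vfield \<Rightarrow> 'a \<Rightarrow> real" where
  "nabla_du u Y Z p = vf_apply At Y (vf_apply At Z u) p - differential At u p (nabla p (Y p) Z)"

definition nabla_du_at :: "('a \<Rightarrow> real) \<Rightarrow> 'a \<Rightarrow> real^'n \<Rightarrow> real^'n \<Rightarrow> real" where
  "nabla_du_at u p v w = nabla_du u (coord_field At p v) (coord_field At p w) p"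

end

context
  fixes At :: "('a::topological_space, 'n::finite) chart set"
    and T10 :: "'a \<Rightarrow> (complex^'n) set"
    and \<theta> :: "'a \<Rightarrow> real^'n \<Rightarrow> real"
    and nabla :: "('a, 'n) connection"
begin

text \<open>In order: \<open>H\<close> is parallel, \<open>nabla J = 0\<close>, the metric is parallel, and the two torsion
  conditions.\<close>

definition tanaka_webster :: bool where
  "tanaka_webster \<longleftrightarrow> linear_connection At nabla \<and>
     (\<forall>W. open W \<longrightarrow>
        (\<forall>X Y. smooth_vf At W X \<and> smooth_vf At W Y \<and> (\<forall>q\<in>W. Y q \<in> levi_dist T10 q) \<longrightarrow>
           (\<forall>q\<in>W. nabla q (X q) Y \<in> levi_dist T10 q)) \<and>
        (\<forall>X Y. smooth_vf At W X \<and> smooth_vf At W Y \<longrightarrow>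
           (\<forall>q\<in>W. nabla q (X q) (\<lambda>r. J At T10 \<theta> r (Y r)) = J At T10 \<theta> q (nabla q (X q) Y))) \<and>
        (\<forall>X Y Z. smooth_vf At W X \<and> smooth_vf At W Y \<and> smooth_vf At W Z \<longrightarrow>
           (\<forall>q\<in>W. vf_apply At X (\<lambda>r. webster_metric At T10 \<theta> r (Y r) (Z r)) q =
              webster_metric At T10 \<theta> q (nabla q (X q) Y) (Z q) +
              webster_metric At T10 \<theta> q (Y q) (nabla q (X q) Z))) \<and>
        (\<forall>X Y. smooth_vf At W X \<and> smooth_vf At W Y \<and>
               (\<forall>q\<in>W. X q \<in> levi_dist T10 q \<and> Y q \<in> levi_dist T10 q) \<longrightarrow>
           (\<forall>q\<in>W. torsion At nabla X Y q = (2 * ext_deriv At \<theta> X Y q) *\<^sub>R reeb At \<theta> q)) \<and>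
        (\<forall>X. smooth_vf At W X \<and> (\<forall>q\<in>W. X q \<in> levi_dist T10 q) \<longrightarrow>
           (\<forall>q\<in>W. torsion At nabla (reeb At \<theta>) (\<lambda>r. J At T10 \<theta> r (X r)) q +
                  J At T10 \<theta> q (torsion At nabla (reeb At \<theta>) X q) = 0)))"

definition orthonormal_basis_H :: "'a \<Rightarrow> (real^'n) set \<Rightarrow> bool" where
  "orthonormal_basis_H p B \<longleftrightarrow> finite B \<and> span B = levi_dist T10 p \<and>
     (\<forall>e\<in>B. \<forall>e'\<in>B. webster_metric At T10 \<theta> p e e' = (if e = e' then 1 else 0))"

text \<open>The trace over \<open>H\<close>; its value does not depend on the chosen orthonormal basis.\<close>

definition sub_laplacian :: "('a \<Rightarrow> real) \<Rightarrow> 'a \<Rightarrow> real" where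
  "sub_laplacian u p =
     (let B = (SOME B. orthonormal_basis_H p B) in \<Sum>e\<in>B. nabla_du_at At nabla u p e e)"

end

section \<open>The nonlinearity\<close>

definition partial1 :: "(real \<Rightarrow> real \<Rightarrow> real) \<Rightarrow> real \<Rightarrow> real \<Rightarrow> real" where
  "partial1 h x1 x2 = deriv (\<lambda>s. h s x2) x1"

definition partial2 :: "(real \<Rightarrow> real \<Rightarrow> real) \<Rightarrow> real \<Rightarrow> real \<Rightarrow> real" where
  "partial2 h x1 x2 = deriv (\<lambda>s. h x1 s) x2"

definition hessian2 :: "(real \<Rightarrow> real \<Rightarrow> real) \<Rightarrow> real \<Rightarrow> real \<Rightarrow> real^2^2" where
  "hessian2 h x1 x2 =
     vector [vector [partial1 (partial1 h) x1 x2, partial2 (partial1 h) x1 x2],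
             vector [partial1 (partial2 h) x1 x2, partial2 (partial2 h) x1 x2]]"

definition positive_semidefinite :: "real^'k^'k \<Rightarrow> bool" where
  "positive_semidefinite S \<longleftrightarrow> transpose S = S \<and> (\<forall>v. v \<bullet> (S *v v) \<ge> 0)"

end

theory Submission
  imports Defs
begin

text \<open>
  For a primitive \<open>\<psi>\<close> of \<open>1 / sqrt G\<close> the function \<open>\<Psi> = \<psi>(\<gamma>)\<close> is proper, and its gradient and sub-Laplacian
  are bounded above outside a compact set. Maximizing \<open>w - \<delta> \<Psi>\<close> and letting \<open>\<delta> \<rightarrow> 0\<close> gives, for every
  \<open>w\<close> bounded above, points where \<open>w\<close> is almost maximal, its gradient is small and its sub-Laplacian is at most
  slightly positive (an Omori-Yau principle). At such points the tangent plane bound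
  \<open>\<phi>(t,x\<^sub>1,x\<^sub>2) \<ge> f(t) + x\<^sub>1 \<partial>\<^sub>1\<phi>(t,0,0) + x\<^sub>2 \<partial>\<^sub>2\<phi>(t,0,0)\<close> makes the gradient terms negligible: if \<open>u\<close> is bounded
  above, this yields \<open>f(sup u) \<le> 0\<close>. If \<open>u\<close> were unbounded, one takes \<open>w = g(u)\<close> with
  \<open>g' = 1 / sqrt (\<integral>F)\<close>, which is bounded by the Keller-Osserman condition; the differential inequality then
  forces \<open>F / sqrt (\<integral>F)\<close> to tend to 0 along the sequence, whereas the growth of \<open>\<integral>F\<close> keeps it away from 0.

  The Hessian of \<open>u\<close> is computed in the preferred chart; the connection contributes a first-order term that
  is linear in \<open>du\<close> and therefore harmless.
\<close>

section \<open>Second-order calculus along lines\<close>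

text \<open>Pointwise second differentiability in fixed directions is what the second derivative
  test uses, and it passes to \<open>g (F x)\<close> as soon as \<open>g1\<close> is
  differentiable.\<close>

definition twice_differentiable_on :: "('v::real_normed_vector \<Rightarrow> real) \<Rightarrow> 'v set \<Rightarrow> bool" where
  "twice_differentiable_on F S \<longleftrightarrow>
     (\<forall>y\<in>S. F differentiable (at y) \<and>
        (\<forall>v. (\<lambda>x. frechet_derivative F (at x) v) differentiable (at y)))"

definition second_deriv :: "('v::real_normed_vector \<Rightarrow> real) \<Rightarrow> 'v \<Rightarrow> 'v \<Rightarrow> real" where
  "second_deriv F y v = frechet_derivative (\<lambda>x. frechet_derivative F (at x) v) (at y) v"

lemma Ck_on_2_imp_twice_differentiable:
  fixes F :: "'v::real_normed_vector \<Rightarrow> real"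
  shows "Ck_on 2 F S \<Longrightarrow> twice_differentiable_on F S"
  by (auto simp: twice_differentiable_on_def numeral_2_eq_2)

text \<open>Both functions have the same derivatives at \<open>x\<close>, possibly none, so the
  choice behind \<open>frechet_derivative\<close> picks the same map.\<close>

lemma frechet_derivative_cong_open:
  assumes "open S" "x \<in> S" "\<And>y. y \<in> S \<Longrightarrow> f y = g y"
  shows "frechet_derivative f (at x) = frechet_derivative g (at x)"
proof -
  have "(f has_derivative D) (at x) \<longleftrightarrow> (g has_derivative D) (at x)" for D
    using assms has_derivative_transform_within_open[of f D x UNIV S g]
      has_derivative_transform_within_open[of g D x UNIV S f] by auto
  then show ?thesis by (simp add: frechet_derivative_def)
qed

lemma has_real_derivative_along_line:
  fixes F :: "'v::real_normed_vector \<Rightarrow> real"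
  assumes "F differentiable (at (y + t *\<^sub>R v))"
  shows "((\<lambda>s. F (y + s *\<^sub>R v)) has_real_derivative frechet_derivative F (at (y + t *\<^sub>R v)) v) (at t)"
proof -
  let ?D = "frechet_derivative F (at (y + t *\<^sub>R v))"
  have D: "(F has_derivative ?D) (at (y + t *\<^sub>R v))"
    using assms by (simp add: frechet_derivative_works)
  have "((\<lambda>s. y + s *\<^sub>R v) has_derivative (\<lambda>s. s *\<^sub>R v)) (at t)"
    by (auto intro!: derivative_eq_intros)
  from has_derivative_compose[OF this D]
  have "((\<lambda>s. F (y + s *\<^sub>R v)) has_derivative (\<lambda>s. ?D (s *\<^sub>R v))) (at t)" .
  moreover have "?D (s *\<^sub>R v) = s * ?D v" for s
    using linear_frechet_derivative[OF assms] by (simp add: linear_cmul)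
  ultimately show ?thesis
    by (simp add: has_field_derivative_def mult_commute_abs)
qed

lemma twice_differentiable_compose:
  fixes F :: "'v::real_normed_vector \<Rightarrow> real"
  assumes S: "open S" and F: "twice_differentiable_on F S"
    and g: "\<And>t. (g has_real_derivative g1 t) (at t)"
    and g1: "\<And>t. (g1 has_real_derivative g2 t) (at t)"
  shows "twice_differentiable_on (\<lambda>x. g (F x)) S"
    and "y \<in> S \<Longrightarrow> frechet_derivative (\<lambda>x. g (F x)) (at y) v = g1 (F y) * frechet_derivative F (at y) v"
    and "y \<in> S \<Longrightarrow> second_deriv (\<lambda>x. g (F x)) y v
            = g1 (F y) * second_deriv F y v + g2 (F y) * (frechet_derivative F (at y) v)\<^sup>2"
proof -
  have comp: "((\<lambda>x. h (F x)) has_derivative (\<lambda>v. h' * frechet_derivative F (at y) v)) (at y)"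
    if "y \<in> S" "(h has_real_derivative h') (at (F y))" for y h h'
  proof -
    have "(F has_derivative frechet_derivative F (at y)) (at y)"
      using F that by (auto simp: twice_differentiable_on_def frechet_derivative_works)
    from has_derivative_compose[OF this that(2)[unfolded has_field_derivative_def]]
    show ?thesis by simp
  qed
  have d1: "frechet_derivative (\<lambda>x. g (F x)) (at y) v = g1 (F y) * frechet_derivative F (at y) v"
    if "y \<in> S" for y v
    using frechet_derivative_at[OF comp[OF that g]] by metis
  have d2: "((\<lambda>x. frechet_derivative (\<lambda>x. g (F x)) (at x) v) has_derivative
       (\<lambda>w. g1 (F y) * frechet_derivative (\<lambda>x. frechet_derivative F (at x) v) (at y) w
          + g2 (F y) * frechet_derivative F (at y) w * frechet_derivative F (at y) v)) (at y)"
    if y: "y \<in> S" for y v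
  proof -
    have "((\<lambda>x. frechet_derivative F (at x) v) has_derivative
        frechet_derivative (\<lambda>x. frechet_derivative F (at x) v) (at y)) (at y)"
      using F y by (auto simp: twice_differentiable_on_def frechet_derivative_works)
    from has_derivative_mult[OF comp[OF y g1] this]
    have "((\<lambda>x. g1 (F x) * frechet_derivative F (at x) v) has_derivative
       (\<lambda>w. g1 (F y) * frechet_derivative (\<lambda>x. frechet_derivative F (at x) v) (at y) w
          + g2 (F y) * frechet_derivative F (at y) w * frechet_derivative F (at y) v)) (at y)" .
    then show ?thesis
      by (rule has_derivative_transform_within_open[OF _ S y]) (simp add: d1)
  qed
  show "twice_differentiable_on (\<lambda>x. g (F x)) S"
    unfolding twice_differentiable_on_def using comp[OF _ g] d2 by (meson differentiableI)
  show "y \<in> S \<Longrightarrow> frechet_derivative (\<lambda>x. g (F x)) (at y) v = g1 (F y) * frechet_derivative F (at y) v"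
    by (rule d1)
  show "second_deriv (\<lambda>x. g (F x)) y v
            = g1 (F y) * second_deriv F y v + g2 (F y) * (frechet_derivative F (at y) v)\<^sup>2" if "y \<in> S"
    unfolding second_deriv_def frechet_derivative_at[OF d2[OF that], symmetric]
    by (simp add: power2_eq_square)
qed

text \<open>If \<open>l\<close> were positive, \<open>k'\<close> would be positive just to the right
  of its zero at \<open>0\<close>, and the mean value theorem would give a value of \<open>k\<close>
  above its maximum.\<close>

lemma second_derivative_test:
  fixes k k' :: "real \<Rightarrow> real"
  assumes d: "0 < d" and k: "\<And>t. \<bar>t\<bar> < d \<Longrightarrow> (k has_real_derivative k' t) (at t)"
    and k': "(k' has_real_derivative l) (at 0)"
    and max: "\<And>t. \<bar>t\<bar> < d \<Longrightarrow> k t \<le> k 0"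
  shows "k' 0 = 0" and "l \<le> 0"
proof -
  show 0: "k' 0 = 0"
    by (rule DERIV_local_max[OF k[of 0] d]) (use d max in auto)
  show "l \<le> 0"
  proof (rule ccontr)
    assume "\<not> l \<le> 0"
    then obtain e where e: "e > 0" "\<And>h. 0 < h \<Longrightarrow> h < e \<Longrightarrow> k' 0 < k' (0 + h)"
      using DERIV_pos_inc_right[OF k'] by auto
    define b where "b = min d e / 2"
    have b: "0 < b" "b < d" "b < e" using d e by (auto simp: b_def)
    obtain z where z: "0 < z" "z < b" "k b - k 0 = (b - 0) * k' z"
      using MVT2[of 0 b k k'] k b by force
    have "k' z > 0" using e(2)[of z] z b 0 by auto
    then have "k b > k 0" using z b by (metis diff_gt_0_iff_gt diff_zero mult_pos_pos)
    then show False using max[of b] b by auto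
  qed
qed

text \<open>On the line through \<open>y\<close> with direction \<open>v\<close> the difference
  \<open>F - G\<close> has a local maximum at parameter \<open>0\<close>, so the one-dimensional
  test applies direction by direction.\<close>

lemma maximum_of_difference:
  fixes F G :: "'v::real_normed_vector \<Rightarrow> real"
  assumes S: "open S" and y: "y \<in> S"
    and F: "twice_differentiable_on F S" and G: "twice_differentiable_on G S"
    and max: "\<And>x. x \<in> S \<Longrightarrow> F x - G x \<le> F y - G y"
  shows "frechet_derivative F (at y) v = frechet_derivative G (at y) v"
    and "second_deriv F y v \<le> second_deriv G y v"
proof -
  have "open ((\<lambda>t::real. y + t *\<^sub>R v) -` S)"
    by (intro open_vimage S continuous_intros)
  moreover have "0 \<in> (\<lambda>t::real. y + t *\<^sub>R v) -` S" using y by simp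
  ultimately obtain d where d: "d > 0" "\<And>t. \<bar>t\<bar> < d \<Longrightarrow> y + t *\<^sub>R v \<in> S"
    unfolding open_contains_ball by (metis (no_types) abs_minus_cancel diff_0 dist_real_def mem_ball subset_iff vimageE)
  let ?k = "\<lambda>t. F (y + t *\<^sub>R v) - G (y + t *\<^sub>R v)"
  let ?k' = "\<lambda>t. frechet_derivative F (at (y + t *\<^sub>R v)) v - frechet_derivative G (at (y + t *\<^sub>R v)) v"
  have k: "(?k has_real_derivative ?k' t) (at t)" if "\<bar>t\<bar> < d" for t
    using d(2)[OF that] F G
    by (intro DERIV_diff has_real_derivative_along_line) (auto simp: twice_differentiable_on_def)
  have k': "(?k' has_real_derivative second_deriv F y v - second_deriv G y v) (at 0)"
    using has_real_derivative_along_line[of "\<lambda>x. frechet_derivative F (at x) v" y 0 v]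
      has_real_derivative_along_line[of "\<lambda>x. frechet_derivative G (at x) v" y 0 v] F G y
    by (intro DERIV_diff) (auto simp: twice_differentiable_on_def second_deriv_def)
  have max': "?k t \<le> ?k 0" if "\<bar>t\<bar> < d" for t
    using max[OF d(2)[OF that]] by simp
  from second_derivative_test[OF d(1) k k' max']
  show "frechet_derivative F (at y) v = frechet_derivative G (at y) v"
    and "second_deriv F y v \<le> second_deriv G y v" by auto
qed

text \<open>The positive nonincreasing function \<open>h\<close> on \<open>[T, \<infinity>)\<close> is continued affinely to the left,
  where it stays positive because its slope is nonpositive.\<close>

lemma concave_primitive_exists:
  fixes h h' :: "real \<Rightarrow> real"
  assumes h: "\<And>t. t \<ge> T \<Longrightarrow> (h has_real_derivative h' t) (at t within {T..})"
    and pos: "\<And>t. t \<ge> T \<Longrightarrow> h t > 0" and neg: "\<And>t. t \<ge> T \<Longrightarrow> h' t \<le> 0"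
  obtains g g1 g2 :: "real \<Rightarrow> real"
  where "\<And>t. (g has_real_derivative g1 t) (at t)"
    and "\<And>t. (g1 has_real_derivative g2 t) (at t)"
    and "\<And>t. g1 t > 0" "\<And>t. g2 t \<le> 0"
    and "\<And>t. t \<ge> T \<Longrightarrow> g1 t = h t" "\<And>t. t \<ge> T \<Longrightarrow> g2 t = h' t" "g T = 0"
proof -
  define g1 where "g1 t = (if t \<in> {T..} then h t else h T + h' T * (t - T))" for t
  define g2 where "g2 t = (if t \<in> {T..} then h' t else h' T)" for t
  have closures: "closure {..<T} = {..T}" "closure {T..} = {T..}"
    "{T..} \<union> ({T..} \<inter> {..T}) = {T..}" "{..<T} \<union> ({T..} \<inter> {..T}) = {..T}" "{T..} \<union> {..<T} = UNIV"
    by auto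
  have g1: "(g1 has_real_derivative g2 t) (at t)" for t
  proof -
    have lin: "((\<lambda>t. h T + h' T * (t - T)) has_derivative (*) (h' T)) (at t within {..T})"
      by (auto intro!: derivative_eq_intros)
    \<comment> \<open>The closures of the two pieces meet only in \<open>T\<close>, where the values
      \<open>h T\<close> and the slopes \<open>h' T\<close> agree; this is what the gluing
      needs.\<close>
    have "(g1 has_derivative (if t \<in> {T..} then (*) (h' t) else (*) (h' T))) (at t within ({T..} \<union> {..<T}))"
      unfolding g1_def[abs_def]
      by (rule has_derivative_If_within_closures[where f' = "\<lambda>t. (*) (h' t)" and g' = "\<lambda>_. (*) (h' T)"])
        (use h[of t] lin in \<open>auto simp: closures has_field_derivative_def\<close>)
    then show ?thesis
      unfolding closures(5) by (auto simp: has_field_derivative_def g2_def split: if_splits)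
  qed
  \<comment> \<open>An antiderivative on the whole line, obtained with infinite end points and
    shifted below so as to vanish at \<open>T\<close>.\<close>
  have "\<exists>g0. \<forall>x::real. -\<infinity> < ereal x \<longrightarrow> ereal x < \<infinity> \<longrightarrow> (g0 has_vector_derivative g1 x) (at x)"
    by (rule einterval_antiderivative) (use g1 DERIV_isCont in auto)
  then obtain g0 where g0: "\<And>x. (g0 has_vector_derivative g1 x) (at x)" by auto
  show thesis
  proof (rule that[of "\<lambda>t. g0 t - g0 T" g1 g2])
    show "((\<lambda>t. g0 t - g0 T) has_real_derivative g1 t) (at t)" for t
      using g0[of t] by (auto simp: has_real_derivative_iff_has_vector_derivative[symmetric] intro!: derivative_eq_intros)
    show "g1 t > 0" for t
    proof (cases "t \<ge> T")
      case False
      then have "h' T * (t - T) \<ge> 0" using neg[of T] by (simp add: mult_nonpos_nonpos)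
      then show ?thesis using False pos[of T] by (simp add: g1_def)
    qed (use pos in \<open>simp add: g1_def\<close>)
    show "g2 t \<le> 0" for t using neg by (simp add: g2_def)
    show "(g1 has_real_derivative g2 t) (at t)" for t by (rule g1)
  qed (auto simp: g1_def g2_def)
qed

section \<open>Charts\<close>

locale smooth_manifold =
  fixes At :: "('a::topological_space, 'n::finite) chart set"
  assumes atlas: "smooth_atlas At"
begin

lemma chart_open:
  assumes "c \<in> At"
  shows "open (fst c)" "open (snd c ` fst c)"
  using atlas assms by (auto simp: smooth_atlas_def is_chart_def)

lemma chart_homeomorphism: "c \<in> At \<Longrightarrow> homeomorphism (fst c) (snd c ` fst c) (snd c) (cinv c)"
  using atlas by (auto simp: smooth_atlas_def is_chart_def)

lemma cinv_chart [simp]: "c \<in> At \<Longrightarrow> q \<in> fst c \<Longrightarrow> cinv c (snd c q) = q"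
  using chart_homeomorphism by (auto simp: homeomorphism_def)

lemma chart_open_image:
  assumes "c \<in> At" "open U"
  shows "open (snd c ` (fst c \<inter> U))"
proof -
  have "openin (top_of_set (snd c ` fst c)) (snd c ` (fst c \<inter> U))"
    using homeomorphism_imp_open_map[OF chart_homeomorphism[OF assms(1)]] assms(2) by blast
  then show ?thesis using chart_open[OF assms(1)] openin_open_trans by blast
qed

lemma chart_at [simp]: "chart_at At p \<in> At" "p \<in> fst (chart_at At p)"
proof -
  have "\<exists>c. c \<in> At \<and> p \<in> fst c"
    using atlas UNIV_I[of p] unfolding smooth_atlas_def by blast
  from someI_ex[OF this] show "chart_at At p \<in> At" "p \<in> fst (chart_at At p)"
    by (auto simp: chart_at_def)
qed

abbreviation origin :: "'a \<Rightarrow> real^'n" where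
  "origin p \<equiv> snd (chart_at At p) p"

section \<open>Change of charts\<close>

lemma transition_differentiable:
  assumes "c \<in> At" "d \<in> At" "q \<in> fst c" "q \<in> fst d"
  shows "(snd d \<circ> cinv c) differentiable (at (snd c q))"
proof -
  have "Ck_on (Suc 0) (snd d \<circ> cinv c) (snd c ` (fst c \<inter> fst d))"
    using atlas assms by (auto simp: smooth_atlas_def smooth_on_def simp del: Ck_on.simps)
  then show ?thesis using assms by auto
qed

text \<open>The chain rule on the overlap of two charts. Besides real functions it is applied to
  coordinate maps, which makes \<open>to_chart\<close> and \<open>from_chart\<close> inverse to each
  other.\<close>

lemma frechet_derivative_change_chart:
  fixes f :: "'a \<Rightarrow> 'w::real_normed_vector"
  assumes c: "c \<in> At" "q \<in> fst c" and d: "d \<in> At" "q \<in> fst d"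
    and f: "(f \<circ> cinv d) differentiable (at (snd d q))"
  shows "frechet_derivative (f \<circ> cinv c) (at (snd c q)) v =
     frechet_derivative (f \<circ> cinv d) (at (snd d q)) (frechet_derivative (snd d \<circ> cinv c) (at (snd c q)) v)"
proof -
  let ?S = "snd c ` (fst c \<inter> fst d)"
  have S: "open ?S" "snd c q \<in> ?S"
    using chart_open_image[OF c(1) chart_open(1)[OF d(1)]] c d by auto
  have "frechet_derivative (f \<circ> cinv c) (at (snd c q))
      = frechet_derivative ((f \<circ> cinv d) \<circ> (snd d \<circ> cinv c)) (at (snd c q))"
    by (rule frechet_derivative_cong_open[OF S]) (use c d in auto)
  also have "\<dots> = frechet_derivative (f \<circ> cinv d) (at ((snd d \<circ> cinv c) (snd c q)))
        \<circ> frechet_derivative (snd d \<circ> cinv c) (at (snd c q))"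
    by (rule frechet_derivative_compose) (use c d f transition_differentiable[OF c(1) d(1) c(2) d(2)] in auto)
  finally show ?thesis using c d by simp
qed

lemma frechet_derivative_chart_id:
  assumes "c \<in> At" "q \<in> fst c"
  shows "frechet_derivative (snd c \<circ> cinv c) (at (snd c q)) v = v"
proof -
  have "frechet_derivative (snd c \<circ> cinv c) (at (snd c q)) = frechet_derivative (\<lambda>y. y) (at (snd c q))"
    by (rule frechet_derivative_cong_open[of "snd c ` fst c"]) (use assms chart_open in auto)
  then show ?thesis by simp
qed

lemma linear_from_chart:
  assumes "c \<in> At" "q \<in> fst c" shows "linear (from_chart At c q)"
  unfolding from_chart_def[abs_def]
  using linear_frechet_derivative[OF transition_differentiable[of c "chart_at At q" q]] assms by simp

lemma to_from_chart [simp]: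
  assumes "c \<in> At" "q \<in> fst c" shows "to_chart At c q (from_chart At c q v) = v"
  using frechet_derivative_change_chart[of c q "chart_at At q" "snd c" v]
    frechet_derivative_chart_id[OF assms] transition_differentiable[of "chart_at At q" c q] assms
  by (simp add: to_chart_def from_chart_def)

lemma from_to_chart [simp]:
  assumes "c \<in> At" "q \<in> fst c" shows "from_chart At c q (to_chart At c q v) = v"
  using frechet_derivative_change_chart[of "chart_at At q" q c "snd (chart_at At q)" v]
    frechet_derivative_chart_id[of "chart_at At q" q] transition_differentiable[of c "chart_at At q" q] assms
  by (simp add: to_chart_def from_chart_def)

lemma from_chart_at [simp]: "from_chart At (chart_at At p) p v = v"
  by (simp add: from_chart_def frechet_derivative_chart_id)

lemma to_chart_at [simp]: "to_chart At (chart_at At p) p v = v"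
  by (simp add: to_chart_def frechet_derivative_chart_id)

lemma coord_field_self [simp]: "coord_field At p v p = v"
  by (simp add: coord_field_def)

text \<open>In the chart at \<open>p\<close> both fields have constant components, so both
  derivative terms of the bracket vanish.\<close>

lemma lie_bracket_coord_field [simp]: "lie_bracket At (coord_field At p v) (coord_field At p w) p = 0"
proof -
  have "frechet_derivative (vf_rep At (chart_at At p) (coord_field At p v)) (at (origin p))
       = frechet_derivative (\<lambda>y. v) (at (origin p))" for v
    by (rule frechet_derivative_cong_open[of "snd (chart_at At p) ` fst (chart_at At p)"])
      (auto simp: chart_open vf_rep_def coord_field_def)
  then show ?thesis by (simp add: lie_bracket_def Let_def)
qed

section \<open>Twice differentiable functions and their Hessian in the preferred chart\<close>

definition twice_differentiable_fun :: "('a \<Rightarrow> real) \<Rightarrow> bool" where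
  "twice_differentiable_fun f \<longleftrightarrow> (\<forall>c\<in>At. twice_differentiable_on (f \<circ> cinv c) (snd c ` fst c))"

lemma Ck_fun_2_imp_twice_differentiable: "Ck_fun At 2 f UNIV \<Longrightarrow> twice_differentiable_fun f"
  by (auto simp: Ck_fun_def twice_differentiable_fun_def intro: Ck_on_2_imp_twice_differentiable)

lemma twice_differentiable_chart:
  assumes "twice_differentiable_fun f" "c \<in> At" "q \<in> fst c"
  shows "(f \<circ> cinv c) differentiable (at (snd c q))"
  using assms by (auto simp: twice_differentiable_fun_def twice_differentiable_on_def)

lemma continuous_twice_differentiable_fun:
  assumes f: "twice_differentiable_fun f" shows "continuous_on UNIV f"
proof -
  have "continuous_on (fst c) f" if c: "c \<in> At" for c
  proof -
    have "continuous_on (snd c ` fst c) (f \<circ> cinv c)"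
      using twice_differentiable_chart[OF f c] differentiable_imp_continuous_within
      by (intro continuous_at_imp_continuous_on) auto
    moreover have "continuous_on (fst c) (snd c)"
      using chart_homeomorphism[OF c] by (auto simp: homeomorphism_def)
    ultimately have "continuous_on (fst c) ((f \<circ> cinv c) \<circ> snd c)"
      using continuous_on_compose by blast
    then show ?thesis
      by (rule continuous_on_eq) (auto simp: c)
  qed
  then have "continuous_on (\<Union>c\<in>At. fst c) f"
    using chart_open(1) by (intro continuous_on_open_Union) auto
  then show ?thesis using atlas by (simp add: smooth_atlas_def)
qed

lemma linear_differential: "twice_differentiable_fun f \<Longrightarrow> linear (differential At f p)"
  unfolding differential_def[abs_def]
  using twice_differentiable_chart[of f "chart_at At p" p] linear_frechet_derivative by auto

text \<open>The coordinate Hessian on the diagonal, which depends on the chart; the connection term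
  in \<open>nabla_du_at_eq\<close> turns it into \<open>\<nabla>du\<close>.\<close>

definition second_differential :: "('a \<Rightarrow> real) \<Rightarrow> 'a \<Rightarrow> real^'n \<Rightarrow> real" where
  "second_differential f p v = second_deriv (f \<circ> cinv (chart_at At p)) (origin p) v"

text \<open>The connection enters only through the single vector \<open>nabla p v (coord_field At p v)\<close>.\<close>

lemma nabla_du_at_eq:
  assumes f: "twice_differentiable_fun f"
  shows "nabla_du_at At nabla f p v v =
     second_differential f p v - differential At f p (nabla p v (coord_field At p v))"
proof -
  let ?c = "chart_at At p"
  have "vf_apply At (coord_field At p v) (vf_apply At (coord_field At p v) f) p
     = frechet_derivative (vf_apply At (coord_field At p v) f \<circ> cinv ?c) (at (origin p)) v"
    by (simp add: vf_apply_def[of _ _ _ p] differential_def[of _ _ p])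
  also have "\<dots> = frechet_derivative (\<lambda>y. frechet_derivative (f \<circ> cinv ?c) (at y) v) (at (origin p)) v"
  proof -
    \<comment> \<open>At each \<open>q\<close> the differential is taken in the chart preferred at
      \<open>q\<close>, into which \<open>coord_field\<close> has transported \<open>v\<close>; the
      change of charts brings both back to the fixed chart \<open>?c\<close>.\<close>
    have "(vf_apply At (coord_field At p v) f \<circ> cinv ?c) y = frechet_derivative (f \<circ> cinv ?c) (at y) v"
      if "y \<in> snd ?c ` fst ?c" for y
    proof -
      from that obtain q where q: "q \<in> fst ?c" "y = snd ?c q" by auto
      show ?thesis
        using frechet_derivative_change_chart[of ?c q "chart_at At q" f v]
          twice_differentiable_chart[OF f, of "chart_at At q" q] q
        by (simp add: vf_apply_def coord_field_def differential_def from_chart_def)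
    qed
    then show ?thesis
      by (subst frechet_derivative_cong_open[of "snd ?c ` fst ?c"]) (auto simp: chart_open)
  qed
  finally show ?thesis
    by (simp add: nabla_du_at_def nabla_du_def second_differential_def second_deriv_def)
qed

lemma twice_differentiable_fun_compose:
  assumes f: "twice_differentiable_fun f"
    and g: "\<And>t. (g has_real_derivative g1 t) (at t)"
    and g1: "\<And>t. (g1 has_real_derivative g2 t) (at t)"
  shows "twice_differentiable_fun (\<lambda>x. g (f x))"
    and "differential At (\<lambda>x. g (f x)) p v = g1 (f p) * differential At f p v"
    and "second_differential (\<lambda>x. g (f x)) p v
            = g1 (f p) * second_differential f p v + g2 (f p) * (differential At f p v)\<^sup>2"
proof -
  have c: "open (snd c ` fst c)" "twice_differentiable_on (f \<circ> cinv c) (snd c ` fst c)" if "c \<in> At" for c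
    using f that chart_open by (auto simp: twice_differentiable_fun_def)
  have o: "(\<lambda>x. g (f x)) \<circ> cinv c = (\<lambda>y. g ((f \<circ> cinv c) y))" for c by auto
  show "twice_differentiable_fun (\<lambda>x. g (f x))"
    unfolding twice_differentiable_fun_def o
    using twice_differentiable_compose(1)[OF c g g1] by blast
  show "differential At (\<lambda>x. g (f x)) p v = g1 (f p) * differential At f p v"
    unfolding differential_def o
    using twice_differentiable_compose(2)[OF c g g1, of "chart_at At p" "origin p"] by simp
  show "second_differential (\<lambda>x. g (f x)) p v
            = g1 (f p) * second_differential f p v + g2 (f p) * (differential At f p v)\<^sup>2"
    unfolding second_differential_def differential_def o
    using twice_differentiable_compose(3)[OF c g g1, of "chart_at At p" "origin p"] by simp
qed

lemma maximum_of_difference_fun: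
  assumes f: "twice_differentiable_fun f" and h: "twice_differentiable_fun h"
    and max: "\<And>x. f x - h x \<le> f p - h p"
  shows "differential At f p v = differential At h p v"
    and "second_differential f p v \<le> second_differential h p v"
proof -
  let ?c = "chart_at At p"
  have "open (snd ?c ` fst ?c)" "origin p \<in> snd ?c ` fst ?c"
    "twice_differentiable_on (f \<circ> cinv ?c) (snd ?c ` fst ?c)"
    "twice_differentiable_on (h \<circ> cinv ?c) (snd ?c ` fst ?c)"
    using f h chart_open by (auto simp: twice_differentiable_fun_def)
  from maximum_of_difference[OF this]
  show "differential At f p v = differential At h p v"
    and "second_differential f p v \<le> second_differential h p v"
    using max by (auto simp: differential_def second_differential_def)
qed

end

section \<open>Linear algebra\<close>

lemma linear_axis_expansion:
  fixes l :: "real^'k::finite \<Rightarrow> real"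
  assumes "linear l" shows "l w = (\<Sum>i\<in>UNIV. w $ i * l (axis i 1))"
proof -
  have "l w = l (\<Sum>i\<in>UNIV. w $ i *\<^sub>R axis i 1)"
    by (simp add: basis_expansion[of w, unfolded scalar_mult_eq_scaleR])
  then show ?thesis by (simp add: linear_sum[OF assms] linear_cmul[OF assms])
qed

text \<open>The map sending \<open>v\<close> to the vector of all \<open>b v (axis i 1)\<close> is
  an injective endomorphism, hence surjective. It serves both for the Reeb vector, where
  \<open>b\<close> is not symmetric, and for the gradient.\<close>

lemma linear_functional_representation:
  fixes b :: "real^'k \<Rightarrow> real^'k \<Rightarrow> real" and l :: "real^'k \<Rightarrow> real"
  assumes lin1: "\<And>w. linear (\<lambda>v. b v w)" and lin2: "\<And>v. linear (b v)"
    and nondeg: "\<And>v. (\<And>w. b v w = 0) \<Longrightarrow> v = 0" and l: "linear l"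
  shows "\<exists>v. \<forall>w. b v w = l w"
proof -
  define L where "L v = (\<chi> i. b v (axis i 1))" for v
  have L: "linear L"
    by (rule linearI) (simp_all add: L_def vec_eq_iff linear_add[OF lin1] linear_cmul[OF lin1])
  have "inj L"
    unfolding linear_injective_0[OF L]
  proof (intro allI impI)
    fix v assume "L v = 0"
    then have 0: "b v (axis i 1) = 0" for i by (simp add: L_def vec_eq_iff)
    show "v = 0" by (rule nondeg, subst linear_axis_expansion[OF lin2]) (simp add: 0)
  qed
  then have "surj L" using linear_injective_imp_surjective[OF L] by simp
  then obtain v where "L v = (\<chi> i. l (axis i 1))" by (metis surjD)
  then have "b v (axis i 1) = l (axis i 1)" for i by (simp add: L_def vec_eq_iff)
  then have "b v w = l w" for w
    unfolding linear_axis_expansion[OF lin2, of v w] linear_axis_expansion[OF l, of w] by simp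
  then show ?thesis by blast
qed

lemma sum_mult_delta:
  fixes c :: "'b \<Rightarrow> real"
  assumes "finite B" "e \<in> B"
  shows "(\<Sum>b\<in>B. c b * (if b = e then 1 else 0)) = c e"
proof -
  have "(\<Sum>b\<in>B. c b * (if b = e then 1 else 0)) = (\<Sum>b\<in>B. if b = e then c b else 0)"
    by (rule sum.cong) auto
  then show ?thesis using assms by simp
qed

text \<open>An orthonormal set in \<open>H\<close> of maximal cardinality spans \<open>H\<close>,
  because otherwise a Gram-Schmidt step would enlarge it.\<close>

lemma orthonormal_basis_exists:
  fixes H :: "'v::euclidean_space set" and g :: "'v \<Rightarrow> 'v \<Rightarrow> real"
  assumes H: "subspace H"
    and lin: "\<And>w. linear (\<lambda>v. g v w)"
    and sym: "\<And>v w. g v w = g w v"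
    and pos: "\<And>v. v \<in> H \<Longrightarrow> v \<noteq> 0 \<Longrightarrow> g v v > 0"
  shows "\<exists>B. finite B \<and> span B = H \<and> (\<forall>e\<in>B. \<forall>e'\<in>B. g e e' = (if e = e' then 1 else 0))"
proof -
  define ortho where "ortho B \<longleftrightarrow> finite B \<and> B \<subseteq> H \<and> (\<forall>e\<in>B. \<forall>e'\<in>B. g e e' = (if e = e' then 1 else 0))" for B
  have gsum: "g (\<Sum>b\<in>B. c b *\<^sub>R b) w = (\<Sum>b\<in>B. c b * g b w)" for c B w
    by (simp add: linear_sum[OF lin] linear_cmul[OF lin])
  have coeff: "g (\<Sum>b\<in>B. c b *\<^sub>R b) e = c e" if "ortho B" "e \<in> B" for B c e
    unfolding gsum using that by (simp add: ortho_def sum_mult_delta)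
  have indep: "independent B" if B: "ortho B" for B
    unfolding independent_explicit
  proof (intro conjI allI impI ballI)
    show "finite B" using B by (simp add: ortho_def)
    fix c e assume "(\<Sum>v\<in>B. c v *\<^sub>R v) = 0" "e \<in> B"
    then show "c e = 0" using coeff[OF B, of e c] linear_0[OF lin] by simp
  qed
  have bound: "card B \<le> DIM('v)" if "ortho B" for B
    using independent_bound[OF indep[OF that]] by simp
  have "ortho {}" by (simp add: ortho_def)
  then have "\<exists>B. ortho B \<and> (\<forall>C. ortho C \<longrightarrow> card C \<le> card B)"
    by (rule ex_has_greatest_nat[where b = "Suc DIM('v)"]) (use bound in \<open>auto simp: less_Suc_eq_le\<close>)
  then obtain B where B: "ortho B" and max: "\<And>C. ortho C \<Longrightarrow> card C \<le> card B" by blast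
  have BH: "span B \<subseteq> H" using B H by (simp add: ortho_def span_minimal)
  moreover have "H \<subseteq> span B"
  proof (rule ccontr)
    assume "\<not> H \<subseteq> span B"
    then obtain v where v: "v \<in> H" "v \<notin> span B" by auto
    \<comment> \<open>The component of \<open>v\<close> orthogonal to \<open>B\<close>; it is
      nonzero because \<open>v\<close> is outside the span, and it stays in
      \<open>H\<close>.\<close>
    define w where "w = v - (\<Sum>b\<in>B. g v b *\<^sub>R b)"
    have sp: "(\<Sum>b\<in>B. g v b *\<^sub>R b) \<in> span B" by (simp add: span_base span_scale span_sum)
    have w: "w \<in> H" "w \<noteq> 0"
      using v sp BH H subspace_diff by (auto simp: w_def)
    have wB: "g w e = 0" if "e \<in> B" for e
      unfolding w_def using coeff[OF B that, of "g v"] by (simp add: linear_diff[OF lin])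
    define e where "e = (1 / sqrt (g w w)) *\<^sub>R w"
    have gw: "g w w > 0" using pos w by simp
    have scale: "g e x = (1 / sqrt (g w w)) * g w x" for x
      unfolding e_def by (simp add: linear_cmul[OF lin])
    have ee: "g e e = 1"
      using gw scale[of e] scale[of w] sym[of w e] by simp
    have eB: "g e b = 0" "g b e = 0" if "b \<in> B" for b
      using scale[of b] wB[OF that] sym[of b e] by auto
    have "e \<notin> B" using eB ee by force
    moreover have "ortho (insert e B)"
      using B ee eB w H \<open>e \<notin> B\<close> by (auto simp: ortho_def e_def subspace_scale)
    ultimately show False using max[of "insert e B"] B by (auto simp: ortho_def)
  qed
  ultimately show ?thesis using B by (auto simp: ortho_def)
qed

text \<open>Expand \<open>g (h - s) (h - s) \<ge> 0\<close> for the projection \<open>s\<close> of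
  \<open>h\<close> to the span of \<open>B\<close>: both \<open>g s h\<close> and
  \<open>g s s\<close> equal the sum of squares.\<close>

lemma Bessel_inequality:
  fixes g :: "'v::real_vector \<Rightarrow> 'v \<Rightarrow> real"
  assumes lin: "\<And>w. linear (\<lambda>v. g v w)" and sym: "\<And>v w. g v w = g w v"
    and nonneg: "\<And>v. g v v \<ge> 0"
    and B: "finite B" "\<And>e e'. e \<in> B \<Longrightarrow> e' \<in> B \<Longrightarrow> g e e' = (if e = e' then 1 else 0)"
  shows "(\<Sum>e\<in>B. (g h e)\<^sup>2) \<le> g h h"
proof -
  define s where "s = (\<Sum>e\<in>B. g h e *\<^sub>R e)"
  have gs: "g s x = (\<Sum>e\<in>B. g h e * g e x)" for x
    unfolding s_def by (simp add: linear_sum[OF lin] linear_cmul[OF lin])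
  have "g s e = g h e" if "e \<in> B" for e
    unfolding gs using B that by (simp add: sum_mult_delta)
  then have ss: "g s s = (\<Sum>e\<in>B. (g h e)\<^sup>2)"
    unfolding gs[of s] by (simp add: sym[of _ s] power2_eq_square)
  have sh: "g s h = (\<Sum>e\<in>B. (g h e)\<^sup>2)"
    unfolding gs by (simp add: sym[of _ h] power2_eq_square)
  have "0 \<le> g (h - s) (h - s)" by (rule nonneg)
  also have "\<dots> = g h (h - s) - g s (h - s)" by (rule linear_diff[OF lin])
  also have "\<dots> = g h h - g s h - (g h s - g s s)"
    by (simp add: sym[of _ "h - s"] linear_diff[OF lin])
  finally show ?thesis using ss sh sym[of h s] by simp
qed

section \<open>The Webster metric\<close>

locale pseudo_hermitian =
  fixes At :: "('a::topological_space, 'n::finite) chart set"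
    and T10 :: "'a \<Rightarrow> (complex^'n) set"
    and \<theta> :: "'a \<Rightarrow> real^'n \<Rightarrow> real"
    and m :: nat
  assumes pseudo_hermitian: "pseudo_hermitian_manifold At T10 \<theta> m"

sublocale pseudo_hermitian \<subseteq> smooth_manifold
  by unfold_locales (use pseudo_hermitian in \<open>simp add: pseudo_hermitian_manifold_def\<close>)

context pseudo_hermitian
begin

abbreviation H :: "'a \<Rightarrow> (real^'n) set" where "H \<equiv> levi_dist T10"
abbreviation D\<theta> :: "'a \<Rightarrow> real^'n \<Rightarrow> real^'n \<Rightarrow> real" where "D\<theta> \<equiv> dform At \<theta>"
abbreviation g\<theta> :: "'a \<Rightarrow> real^'n \<Rightarrow> real^'n \<Rightarrow> real" where "g\<theta> \<equiv> webster_metric At T10 \<theta>"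

lemma theta_linear: "linear (\<theta> p)"
  using pseudo_hermitian by (auto simp: pseudo_hermitian_manifold_def smooth_one_form_def)

lemmas theta_simps [simp] = linear_add[OF theta_linear] linear_diff[OF theta_linear]
  linear_cmul[OF theta_linear] linear_0[OF theta_linear] linear_neg[OF theta_linear]

lemma mem_H_iff: "v \<in> H p \<longleftrightarrow> \<theta> p v = 0"
  using pseudo_hermitian unfolding pseudo_hermitian_manifold_def by blast

lemma subspace_H: "subspace (H p)"
  by (simp add: subspace_def mem_H_iff)

lemma theta_nonzero: "\<exists>v. \<theta> p v \<noteq> 0"
  using pseudo_hermitian by (auto simp: pseudo_hermitian_manifold_def)

section \<open>The form \<open>\<theta>\<close> and its exterior derivative in coordinates\<close>

definition theta_comp :: "('a, 'n) chart \<Rightarrow> real^'n \<Rightarrow> real^'n \<Rightarrow> real" where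
  "theta_comp c v y = \<theta> (cinv c y) (from_chart At c (cinv c y) v)"

lemma theta_comp_differentiable:
  assumes "c \<in> At" "q \<in> fst c" shows "theta_comp c v differentiable (at (snd c q))"
proof -
  have "smooth_on (theta_comp c v) (snd c ` fst c)"
    using pseudo_hermitian assms unfolding theta_comp_def[abs_def]
    by (auto simp: pseudo_hermitian_manifold_def smooth_one_form_def)
  then have "Ck_on (Suc 0) (theta_comp c v) (snd c ` fst c)"
    by (auto simp: smooth_on_def simp del: Ck_on.simps)
  then show ?thesis using assms by auto
qed

lemma linear_theta_comp:
  assumes "c \<in> At" "q \<in> fst c" shows "linear (\<lambda>v. theta_comp c v (snd c q))"
  using linear_compose[OF linear_from_chart[OF assms] theta_linear] assms
  by (simp add: theta_comp_def o_def)

lemma theta_comp_at [simp]: "theta_comp (chart_at At p) v (origin p) = \<theta> p v"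
  by (simp add: theta_comp_def)

text \<open>A coordinate derivative of \<open>\<theta>\<close>, dependent on the chart; half of its
  antisymmetrization is \<open>d\<theta>\<close>.\<close>

definition dtheta_comp :: "'a \<Rightarrow> real^'n \<Rightarrow> real^'n \<Rightarrow> real" where
  "dtheta_comp p v w = frechet_derivative (theta_comp (chart_at At p) w) (at (origin p)) v"

lemma dtheta_comp_has_derivative:
  "(theta_comp (chart_at At p) w has_derivative (\<lambda>v. dtheta_comp p v w)) (at (origin p))"
  unfolding dtheta_comp_def
  using theta_comp_differentiable[of "chart_at At p" p w] by (simp add: frechet_derivative_works)

lemma linear_dtheta_comp1: "linear (\<lambda>v. dtheta_comp p v w)"
  using dtheta_comp_has_derivative has_derivative_linear by blast

text \<open>The components of \<open>\<theta>\<close> are linear in \<open>w\<close> at every point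
  of the chart; uniqueness of derivatives transfers this to \<open>dtheta_comp\<close>.\<close>

lemma linear_dtheta_comp2: "linear (\<lambda>w. dtheta_comp p v w)"
proof -
  let ?c = "chart_at At p"
  let ?S = "snd ?c ` fst ?c"
  have S: "open ?S" "origin p \<in> ?S" by (auto simp: chart_open)
  note tr = has_derivative_transform_within_open[OF _ S]
  have "(theta_comp ?c (w + w') has_derivative (\<lambda>v. dtheta_comp p v w + dtheta_comp p v w')) (at (origin p))" for w w'
    by (rule tr[OF has_derivative_add[OF dtheta_comp_has_derivative dtheta_comp_has_derivative]])
      (use linear_add[OF linear_theta_comp[of ?c]] in auto)
  from has_derivative_unique[OF dtheta_comp_has_derivative this]
  have 1: "dtheta_comp p v (w + w') = dtheta_comp p v w + dtheta_comp p v w'" for w w' by metis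
  have "(theta_comp ?c (r *\<^sub>R w) has_derivative (\<lambda>v. r *\<^sub>R dtheta_comp p v w)) (at (origin p))" for r w
    by (rule tr[OF has_derivative_scaleR_right[OF dtheta_comp_has_derivative]])
      (use linear_cmul[OF linear_theta_comp[of ?c]] in auto)
  from has_derivative_unique[OF dtheta_comp_has_derivative this]
  have 2: "dtheta_comp p v (r *\<^sub>R w) = r *\<^sub>R dtheta_comp p v w" for r w by metis
  show ?thesis using 1 2 by (rule linearI)
qed

text \<open>The bracket term disappears because coordinate fields commute at
  \<open>p\<close>.\<close>

lemma dform_eq: "D\<theta> p v w = (dtheta_comp p v w - dtheta_comp p w v) / 2"
proof -
  let ?c = "chart_at At p"
  have "vf_apply At (coord_field At p v) (\<lambda>q. \<theta> q (coord_field At p w q)) p = dtheta_comp p v w" for v w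
    by (simp add: vf_apply_def differential_def dtheta_comp_def theta_comp_def[abs_def] coord_field_def o_def)
  then show ?thesis by (simp add: dform_def ext_deriv_def)
qed

lemma linear_dform1: "linear (\<lambda>v. D\<theta> p v w)"
  unfolding dform_eq
  by (rule linearI)
    (simp_all add: linear_add[OF linear_dtheta_comp1] linear_add[OF linear_dtheta_comp2]
      linear_cmul[OF linear_dtheta_comp1] linear_cmul[OF linear_dtheta_comp2] field_simps)

lemma dform_antisym: "D\<theta> p v w = - D\<theta> p w v"
  by (simp add: dform_eq field_simps)

lemma linear_dform2: "linear (\<lambda>w. D\<theta> p v w)"
  unfolding dform_antisym[of p v] using linear_compose_neg[OF linear_dform1] .

lemmas dform_simps = linear_add[OF linear_dform1] linear_diff[OF linear_dform1]
  linear_cmul[OF linear_dform1] linear_0[OF linear_dform1] linear_neg[OF linear_dform1]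
  linear_add[OF linear_dform2] linear_diff[OF linear_dform2]
  linear_cmul[OF linear_dform2] linear_0[OF linear_dform2] linear_neg[OF linear_dform2]

lemma dform_self [simp]: "D\<theta> p v v = 0"
  using dform_antisym[of p v v] by simp

lemma vf_rep_differentiable:
  assumes "smooth_vf At U X" "p \<in> U"
  shows "vf_rep At (chart_at At p) X differentiable (at (origin p))"
proof -
  have "Ck_on (Suc 0) (vf_rep At (chart_at At p) X) (snd (chart_at At p) ` (fst (chart_at At p) \<inter> U))"
    using assms chart_at by (auto simp: smooth_vf_def smooth_on_def simp del: Ck_on.simps)
  then show ?thesis using assms by auto
qed

text \<open>Differentiating \<open>\<theta>(Y) = 0\<close> in the direction \<open>X\<close> turns the derivative of the components of
  \<open>\<theta>\<close> into a derivative of the components of \<open>Y\<close>.\<close>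

lemma dtheta_comp_horizontal:
  assumes U: "open U" "p \<in> U" and Y: "smooth_vf At U Y" "\<And>q. q \<in> U \<Longrightarrow> \<theta> q (Y q) = 0"
  shows "dtheta_comp p v (Y p) = - \<theta> p (frechet_derivative (vf_rep At (chart_at At p) Y) (at (origin p)) v)"
proof -
  let ?c = "chart_at At p"
  let ?Y = "vf_rep At ?c Y"
  let ?D = "frechet_derivative ?Y (at (origin p))"
  let ?S = "snd ?c ` (fst ?c \<inter> U)"
  have S: "open ?S" "origin p \<in> ?S"
    using chart_open_image[of ?c U] U by auto
  have D: "(?Y has_derivative ?D) (at (origin p))"
    using vf_rep_differentiable[OF Y(1) U(2)] by (simp add: frechet_derivative_works)
  have comp: "((\<lambda>y. ?Y y $ i) has_derivative (\<lambda>v. ?D v $ i)) (at (origin p))" for i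
    using bounded_linear.has_derivative[OF bounded_linear_vec_nth D] .
  have Yp: "?Y (origin p) = Y p" by (simp add: vf_rep_def)
  \<comment> \<open>The product rule for \<open>\<theta>(Y)\<close> written in components, a
    function that vanishes identically near \<open>p\<close>.\<close>
  have "((\<lambda>y. \<Sum>i\<in>UNIV. ?Y y $ i * theta_comp ?c (axis i 1) y) has_derivative
      (\<lambda>v. \<Sum>i\<in>UNIV. ?Y (origin p) $ i * dtheta_comp p v (axis i 1) + ?D v $ i * theta_comp ?c (axis i 1) (origin p)))
     (at (origin p))"
    by (intro has_derivative_sum has_derivative_mult comp dtheta_comp_has_derivative)
  then have "((\<lambda>y. 0) has_derivative
      (\<lambda>v. \<Sum>i\<in>UNIV. ?Y (origin p) $ i * dtheta_comp p v (axis i 1) + ?D v $ i * theta_comp ?c (axis i 1) (origin p)))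
     (at (origin p))"
  proof (rule has_derivative_transform_within_open[OF _ S])
    fix y assume "y \<in> ?S"
    then obtain q where q: "q \<in> fst ?c" "q \<in> U" "y = snd ?c q" by auto
    show "(\<Sum>i\<in>UNIV. ?Y y $ i * theta_comp ?c (axis i 1) y) = 0"
      using linear_axis_expansion[OF linear_theta_comp[of ?c q], of "?Y y", symmetric] Y(2)[of q] q
      by (simp add: theta_comp_def vf_rep_def)
  qed
  from has_derivative_unique[OF this has_derivative_const]
  have "(\<Sum>i\<in>UNIV. Y p $ i * dtheta_comp p v (axis i 1)) + (\<Sum>i\<in>UNIV. ?D v $ i * \<theta> p (axis i 1)) = 0"
    unfolding Yp theta_comp_at sum.distrib by metis
  then show ?thesis
    using linear_axis_expansion[OF linear_dtheta_comp2, of p v "Y p"] linear_axis_expansion[OF theta_linear, of p "?D v"] by simp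
qed

text \<open>In the difference of two instances of \<open>dtheta_comp_horizontal\<close> the
  derivatives of the components of \<open>X\<close> and \<open>Y\<close> assemble into the bracket.
  This carries the formula for \<open>d\<theta>\<close> from coordinate fields to horizontal
  ones.\<close>

lemma dform_horizontal:
  assumes U: "open U" "p \<in> U"
    and X: "smooth_vf At U X" "\<And>q. q \<in> U \<Longrightarrow> \<theta> q (X q) = 0"
    and Y: "smooth_vf At U Y" "\<And>q. q \<in> U \<Longrightarrow> \<theta> q (Y q) = 0"
  shows "D\<theta> p (X p) (Y p) = - \<theta> p (lie_bracket At X Y p) / 2"
  using dtheta_comp_horizontal[OF U X, of "Y p"] dtheta_comp_horizontal[OF U Y, of "X p"]
  by (simp add: dform_eq lie_bracket_def Let_def field_simps)

section \<open>Involutivity and the symmetry of the Levi form\<close>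

lemma T10_subspace: "vec.subspace (T10 p)"
  using pseudo_hermitian by (auto simp: pseudo_hermitian_manifold_def complex_subbundle_def)

lemma T10_real_part:
  assumes "Z \<in> T10 p" shows "re_vec Z \<in> H p"
proof -
  have "cnj_vec 0 = (0 :: complex^'n)" by (simp add: cnj_vec_def vec_eq_iff)
  then have "0 \<in> cnj_vec ` T10 p" using vec.subspace_0[OF T10_subspace] by (metis imageI)
  then show ?thesis using assms unfolding levi_dist_def by force
qed

text \<open>The vector \<open>- \<i> *s Z\<close> also lies in \<open>T10 p\<close>, and its real
  part is \<open>im_vec Z\<close>.\<close>

lemma T10_imaginary_part:
  assumes "Z \<in> T10 p" shows "im_vec Z \<in> H p"
  using T10_real_part[OF vec.subspace_scale[OF T10_subspace assms, of "- \<i>"]]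
  by (simp add: re_vec_def im_vec_def vec_eq_iff)

text \<open>The complex-bilinear extension of \<open>d\<theta>\<close>. Involutivity makes it vanish on \<open>T10\<close>, and this
  is what the symmetry of the Levi form amounts to.\<close>

definition cdform :: "'a \<Rightarrow> complex^'n \<Rightarrow> complex^'n \<Rightarrow> complex" where
  "cdform p Z W = Complex (D\<theta> p (re_vec Z) (re_vec W) - D\<theta> p (im_vec Z) (im_vec W))
                          (D\<theta> p (re_vec Z) (im_vec W) + D\<theta> p (im_vec Z) (re_vec W))"

lemma re_im_vec_simps:
  "re_vec (Z + W) = re_vec Z + re_vec W" "im_vec (Z + W) = im_vec Z + im_vec W"
  "re_vec (c *s Z) = Re c *\<^sub>R re_vec Z - Im c *\<^sub>R im_vec Z"
  "im_vec (c *s Z) = Re c *\<^sub>R im_vec Z + Im c *\<^sub>R re_vec Z"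
  "re_vec 0 = (0::real^'k::finite)" "im_vec 0 = (0::real^'k)"
  by (simp_all add: re_vec_def im_vec_def vec_eq_iff)

lemma re_im_of_real_vec:
  "re_vec (of_real_vec v + \<i> *s of_real_vec w) = v" "im_vec (of_real_vec v + \<i> *s of_real_vec w) = w"
  by (simp_all add: re_vec_def im_vec_def of_real_vec_def vec_eq_iff)

lemma cdform_antisym: "cdform p Z W = - cdform p W Z"
  unfolding cdform_def
  using dform_antisym[of p "re_vec Z" "re_vec W"] dform_antisym[of p "im_vec Z" "im_vec W"]
    dform_antisym[of p "re_vec Z" "im_vec W"] dform_antisym[of p "im_vec Z" "re_vec W"]
  by (simp add: complex_eq_iff)

lemma subspace_cdform_kernel: "vec.subspace {Z. cdform p Z W = 0}"
proof -
  have "cdform p (Z + Z') W = cdform p Z W + cdform p Z' W"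
    "cdform p (c *s Z) W = c * cdform p Z W" "cdform p 0 W = 0" for Z Z' c
    by (simp_all add: cdform_def re_im_vec_simps dform_simps complex_eq_iff algebra_simps)
  then show ?thesis by (simp add: vec.subspace_def)
qed

text \<open>The bracket of two local frame sections lies in \<open>T10\<close>, so
  \<open>\<theta>\<close> annihilates its real and imaginary parts; by
  \<open>dform_horizontal\<close> these are, up to a factor, the two components of
  \<open>cdform\<close>.\<close>

lemma cdform_T10:
  assumes "Z \<in> T10 p" "W \<in> T10 p" shows "cdform p Z W = 0"
proof -
  from pseudo_hermitian obtain U E where U: "open U" "p \<in> U"
    and E: "\<And>i. i < m \<Longrightarrow> smooth_cvf At U (E i)"
    and span: "\<And>q. q \<in> U \<Longrightarrow> T10 q = vec.span ((\<lambda>i. E i q) ` {..<m})"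
    unfolding pseudo_hermitian_manifold_def complex_subbundle_def by metis
  have mem: "E i q \<in> T10 q" if "i < m" "q \<in> U" for i q
    using that span by (auto intro: vec.span_base)
  have frame: "cdform p (E i p) (E j p) = 0" if "i < m" "j < m" for i j
  proof -
    have "involutive At T10" using pseudo_hermitian by (simp add: pseudo_hermitian_manifold_def)
    then have "clie_bracket At (E i) (E j) p \<in> T10 p"
      using U E[OF that(1)] E[OF that(2)] mem[OF that(1)] mem[OF that(2)]
      unfolding involutive_def by blast
    from T10_real_part[OF this] T10_imaginary_part[OF this]
    have *: "\<theta> p (lie_bracket At (\<lambda>q. re_vec (E i q)) (\<lambda>q. re_vec (E j q)) p) =
        \<theta> p (lie_bracket At (\<lambda>q. im_vec (E i q)) (\<lambda>q. im_vec (E j q)) p)"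
      "\<theta> p (lie_bracket At (\<lambda>q. re_vec (E i q)) (\<lambda>q. im_vec (E j q)) p) =
        - \<theta> p (lie_bracket At (\<lambda>q. im_vec (E i q)) (\<lambda>q. re_vec (E j q)) p)"
      by (simp_all add: mem_H_iff clie_bracket_def Let_def re_im_of_real_vec)
    have hor: "\<theta> q (re_vec (E i q)) = 0" "\<theta> q (im_vec (E i q)) = 0" if "i < m" "q \<in> U" for i q
      using T10_real_part[OF mem[OF that]] T10_imaginary_part[OF mem[OF that]] by (simp_all add: mem_H_iff)
    have sm: "smooth_vf At U (\<lambda>q. re_vec (E i q))" "smooth_vf At U (\<lambda>q. im_vec (E i q))" if "i < m" for i
      using E[OF that] by (simp_all add: smooth_cvf_def)
    note d = dform_horizontal[OF U]
    show ?thesis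
      unfolding cdform_def
      using d[OF sm(1)[OF that(1)] hor(1)[OF that(1)] sm(1)[OF that(2)] hor(1)[OF that(2)]]
        d[OF sm(2)[OF that(1)] hor(2)[OF that(1)] sm(2)[OF that(2)] hor(2)[OF that(2)]]
        d[OF sm(1)[OF that(1)] hor(1)[OF that(1)] sm(2)[OF that(2)] hor(2)[OF that(2)]]
        d[OF sm(2)[OF that(1)] hor(2)[OF that(1)] sm(1)[OF that(2)] hor(1)[OF that(2)]] *
      by (simp add: complex_eq_iff)
  qed
  \<comment> \<open>Linearity in the first argument passes from the frame to its span; antisymmetry
    then does the same for the second argument.\<close>
  have 1: "cdform p Z (E j p) = 0" if "Z \<in> T10 p" "j < m" for Z j
    using vec.span_minimal[OF _ subspace_cdform_kernel, of "(\<lambda>i. E i p) ` {..<m}" p "E j p"]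
      frame that span[OF U(2)] by auto
  have "cdform p W Z = 0"
    using vec.span_minimal[OF _ subspace_cdform_kernel, of "(\<lambda>i. E i p) ` {..<m}" p Z]
      1[OF assms(1)] assms span[OF U(2)] cdform_antisym[of p _ Z] by auto
  then show ?thesis using cdform_antisym[of p Z W] by simp
qed

text \<open>Since \<open>W\<close> and its conjugate have the same real part, the average
  \<open>X\<close> of \<open>Z\<close> and \<open>W\<close> satisfies
  \<open>re_vec (Z + cnj_vec W) = 2 *\<^sub>R re_vec X\<close>.\<close>

lemma H_eq: "H p = {2 *\<^sub>R re_vec Z | Z. Z \<in> T10 p}"
proof (intro equalityI subsetI)
  fix v assume "v \<in> H p"
  then obtain Z W where ZW: "Z \<in> T10 p" "W \<in> T10 p" "v = re_vec (Z + cnj_vec W)"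
    by (auto simp: levi_dist_def)
  define X where "X = (1/2) *s (Z + W)"
  have "X \<in> T10 p"
    unfolding X_def using ZW T10_subspace vec.subspace_add vec.subspace_scale by blast
  moreover have "v = 2 *\<^sub>R re_vec X"
    using ZW by (simp add: X_def re_vec_def cnj_vec_def vec_eq_iff)
  ultimately show "v \<in> {2 *\<^sub>R re_vec Z | Z. Z \<in> T10 p}" by blast
next
  fix v assume "v \<in> {2 *\<^sub>R re_vec Z | Z. Z \<in> T10 p}"
  then show "v \<in> H p" using T10_real_part subspace_H subspace_scale by blast
qed

text \<open>The vector \<open>2 *\<^sub>R re_vec Z\<close> is the sum of \<open>Z\<close> and its
  conjugate, and \<open>\<i>\<close> times their difference is
  \<open>- 2 *\<^sub>R im_vec Z\<close>.\<close>

lemma JH_eq: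
  assumes Z: "Z \<in> T10 p" shows "JH T10 p (2 *\<^sub>R re_vec Z) = - 2 *\<^sub>R im_vec Z"
  unfolding JH_def
proof (rule the_equality)
  have "of_real_vec (2 *\<^sub>R re_vec Z) = Z + cnj_vec Z" "of_real_vec (- 2 *\<^sub>R im_vec Z) = \<i> *s (Z - cnj_vec Z)"
    by (simp_all add: of_real_vec_def re_vec_def im_vec_def cnj_vec_def vec_eq_iff complex_eq_iff)
  then show "\<exists>X\<in>T10 p. of_real_vec (2 *\<^sub>R re_vec Z) = X + cnj_vec X \<and>
      of_real_vec (- 2 *\<^sub>R im_vec Z) = \<i> *s (X - cnj_vec X)" using Z by blast
  fix w assume "\<exists>X\<in>T10 p. of_real_vec (2 *\<^sub>R re_vec Z) = X + cnj_vec X \<and>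
      of_real_vec w = \<i> *s (X - cnj_vec X)"
  then obtain X where X: "X \<in> T10 p" "of_real_vec (2 *\<^sub>R re_vec Z) = X + cnj_vec X"
    "of_real_vec w = \<i> *s (X - cnj_vec X)" by blast
  have re: "re_vec X = re_vec Z"
    using X(2) by (simp add: of_real_vec_def re_vec_def cnj_vec_def vec_eq_iff complex_eq_iff)
  \<comment> \<open>With equal real parts, \<open>X - Z\<close> is the conjugate of its own negative
    and so lies in \<open>T10 p\<close> and in the conjugate space, which meet in zero only.\<close>
  have "X - Z \<in> T10 p" using vec.subspace_diff[OF T10_subspace X(1) Z] .
  moreover have "X - Z = cnj_vec ((-1) *s (X - Z))"
    using re by (simp add: re_vec_def cnj_vec_def vec_eq_iff complex_eq_iff)
  ultimately have "X - Z \<in> T10 p \<inter> cnj_vec ` T10 p"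
    using vec.subspace_scale[OF T10_subspace] by blast
  moreover have "T10 p \<inter> cnj_vec ` T10 p = {0}"
    using pseudo_hermitian by (simp add: pseudo_hermitian_manifold_def)
  ultimately have "X = Z" by auto
  then show "w = - 2 *\<^sub>R im_vec Z"
    using X(3) by (simp add: of_real_vec_def im_vec_def cnj_vec_def vec_eq_iff complex_eq_iff)
qed

lemma JH_mem_H: assumes "v \<in> H p" shows "JH T10 p v \<in> H p"
proof -
  from assms obtain Z where Z: "Z \<in> T10 p" "v = 2 *\<^sub>R re_vec Z" unfolding H_eq by blast
  then show ?thesis
    using JH_eq[OF Z(1)] T10_imaginary_part[OF Z(1)] by (simp add: mem_H_iff)
qed

text \<open>This is the vanishing of the imaginary part of \<open>cdform p Z W\<close>, once
  \<open>J\<close> is expressed by \<open>JH_eq\<close>.\<close>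

lemma levi_form_sym:
  assumes "v \<in> H p" "w \<in> H p" shows "levi_form At T10 \<theta> p v w = levi_form At T10 \<theta> p w v"
proof -
  from assms obtain Z W where ZW: "Z \<in> T10 p" "v = 2 *\<^sub>R re_vec Z" "W \<in> T10 p" "w = 2 *\<^sub>R re_vec W"
    unfolding H_eq by blast
  have "D\<theta> p (re_vec Z) (im_vec W) = D\<theta> p (re_vec W) (im_vec Z)"
    using cdform_T10[OF ZW(1,3)] dform_antisym[of p "im_vec Z" "re_vec W"]
    by (simp add: cdform_def complex_eq_iff)
  then show ?thesis
    using JH_eq[OF ZW(1)] JH_eq[OF ZW(3)] ZW(2,4) by (simp add: levi_form_def dform_simps)
qed

section \<open>Nondegeneracy and the Reeb vector\<close>

lemma levi_form_pos: "v \<in> H p \<Longrightarrow> v \<noteq> 0 \<Longrightarrow> levi_form At T10 \<theta> p v v > 0"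
  using pseudo_hermitian by (auto simp: pseudo_hermitian_manifold_def)

text \<open>Testing with \<open>w = JH T10 p v\<close> gives the Levi form of
  \<open>v\<close>.\<close>

lemma dform_nondegenerate:
  assumes "v \<in> H p" "\<And>w. w \<in> H p \<Longrightarrow> D\<theta> p v w = 0" shows "v = 0"
  using levi_form_pos[OF assms(1)] assms(2)[OF JH_mem_H[OF assms(1)]] by (auto simp: levi_form_def)

text \<open>The Reeb vector represents \<open>\<theta>\<close> with respect to the nondegenerate form \<open>d\<theta> + \<theta> \<otimes> \<theta>\<close>.\<close>

lemma reeb: "\<theta> p (reeb At \<theta> p) = 1" "D\<theta> p (reeb At \<theta> p) w = 0"
proof -
  have nondeg: "v = 0" if "\<And>w. D\<theta> p v w + \<theta> p v * \<theta> p w = 0" for v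
  proof -
    have "\<theta> p v = 0" using that[of v] by simp
    then show ?thesis using that dform_nondegenerate[of v p] by (auto simp: mem_H_iff)
  qed
  have "\<exists>v. \<forall>w. D\<theta> p v w + \<theta> p v * \<theta> p w = \<theta> p w"
    by (rule linear_functional_representation)
      (use nondeg in \<open>auto intro!: linearI simp: dform_simps algebra_simps\<close>)
  then obtain v where v: "\<And>w. D\<theta> p v w + \<theta> p v * \<theta> p w = \<theta> p w" by blast
  \<comment> \<open>Testing with \<open>v\<close> itself leaves the values 0 and 1 for
    \<open>\<theta> p v\<close>. The value 0 would give \<open>d\<theta>(v, .) = \<theta>\<close>,
    which vanishes on \<open>H\<close>, so \<open>v = 0\<close> and then
    \<open>\<theta> = 0\<close>.\<close>
  have "\<theta> p v * (\<theta> p v - 1) = 0" using v[of v] by (simp add: algebra_simps)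
  moreover have "\<theta> p v \<noteq> 0"
  proof
    assume 0: "\<theta> p v = 0"
    then have "v = 0" using v by (intro dform_nondegenerate[of v p]) (auto simp: mem_H_iff)
    then show False using v theta_nonzero[of p] by (auto simp: dform_simps)
  qed
  ultimately have v1: "\<theta> p v = 1" by simp
  have "\<theta> p (reeb At \<theta> p) = 1 \<and> (\<forall>w. D\<theta> p (reeb At \<theta> p) w = 0)"
    unfolding reeb_def
  proof (rule theI[where a = v])
    show "\<theta> p v = 1 \<and> (\<forall>w. D\<theta> p v w = 0)" using v v1 by force
    fix v' assume v': "\<theta> p v' = 1 \<and> (\<forall>w. D\<theta> p v' w = 0)"
    \<comment> \<open>The difference of two candidates is horizontal and in the kernel of
      \<open>d\<theta>\<close>.\<close>
    have "v' - v = 0"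
      by (rule dform_nondegenerate[of _ p]) (use v v1 v' in \<open>auto simp: mem_H_iff dform_simps\<close>)
    then show "v' = v" by simp
  qed
  then show "\<theta> p (reeb At \<theta> p) = 1" "D\<theta> p (reeb At \<theta> p) w = 0" by auto
qed

section \<open>Projections, Webster metric and norm\<close>

abbreviation pH :: "'a \<Rightarrow> real^'n \<Rightarrow> real^'n" where "pH \<equiv> piH At \<theta>"
abbreviation pL :: "'a \<Rightarrow> real^'n \<Rightarrow> real^'n" where "pL \<equiv> piL At \<theta>"

lemma piH_mem: "pH p v \<in> H p"
  by (simp add: mem_H_iff piH_def piL_def reeb)

lemma piH_id: "v \<in> H p \<Longrightarrow> pH p v = v"
  by (simp add: mem_H_iff piH_def piL_def)

lemma piH_piL [simp]: "pH p (pL p v) = 0"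
  by (simp add: piH_def piL_def reeb)

lemma linear_piH: "linear (pH p)"
  by (rule linearI) (simp_all add: piH_def piL_def algebra_simps)

lemma webster_metric_sym: "g\<theta> p v w = g\<theta> p w v"
  using levi_form_sym[OF piH_mem piH_mem] by (simp add: webster_metric_def)

lemma linear_webster_metric: "linear (\<lambda>v. g\<theta> p v w)"
  by (rule linearI)
    (simp_all add: webster_metric_def levi_form_def linear_add[OF linear_piH]
      linear_cmul[OF linear_piH] dform_simps algebra_simps)

lemma linear_webster_metric2: "linear (g\<theta> p v)"
proof -
  have "g\<theta> p v = (\<lambda>w. g\<theta> p w v)" using webster_metric_sym by blast
  then show ?thesis using linear_webster_metric[of p v] by simp
qed

lemma levi_form_nonneg: "v \<in> H p \<Longrightarrow> levi_form At T10 \<theta> p v v \<ge> 0"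
  using levi_form_pos[of v p] by (cases "v = 0") (auto simp: levi_form_def dform_simps)

lemma webster_metric_pos: assumes "v \<noteq> 0" shows "g\<theta> p v v > 0"
proof (cases "pH p v = 0")
  case True
  then have "\<theta> p v \<noteq> 0" using assms by (auto simp: piH_def piL_def)
  then have "\<theta> p v * \<theta> p v > 0" by (simp add: zero_less_mult_iff not_less) linarith
  then show ?thesis using levi_form_nonneg[OF piH_mem, of p v] by (simp add: webster_metric_def add_nonneg_pos)
next
  case False
  then show ?thesis using levi_form_pos[OF piH_mem False] by (simp add: webster_metric_def add_pos_nonneg)
qed

lemma webster_metric_nonneg: "g\<theta> p v v \<ge> 0"
  using webster_metric_pos[of v p] linear_0[OF linear_webster_metric] by (cases "v = 0") auto

abbreviation norm\<theta> :: "'a \<Rightarrow> real^'n \<Rightarrow> real" where "norm\<theta> \<equiv> webster_norm At T10 \<theta>"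

lemma webster_norm_nonneg: "norm\<theta> p v \<ge> 0"
  by (simp add: webster_norm_def webster_metric_nonneg)

lemma webster_norm_scale: "norm\<theta> p (c *\<^sub>R v) = \<bar>c\<bar> * norm\<theta> p v"
  by (simp add: webster_norm_def linear_cmul[OF linear_webster_metric] linear_cmul[OF linear_webster_metric2]
      real_sqrt_mult flip: mult.assoc power2_eq_square)

lemma webster_norm_piH_le: "norm\<theta> p (pH p v) \<le> norm\<theta> p v"
  using piH_mem[of p v] by (simp add: webster_norm_def webster_metric_def piH_id mem_H_iff)

lemma webster_norm_piL_le: "norm\<theta> p (pL p v) \<le> norm\<theta> p v"
proof -
  have "levi_form At T10 \<theta> p 0 0 = 0" by (simp add: levi_form_def dform_simps)
  moreover have "\<theta> p (pL p v) = \<theta> p v" by (simp add: piL_def reeb)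
  ultimately have "g\<theta> p (pL p v) (pL p v) \<le> g\<theta> p v v"
    using levi_form_nonneg[OF piH_mem, of p v] by (simp add: webster_metric_def)
  then show ?thesis by (simp add: webster_norm_def)
qed

section \<open>The gradient\<close>

lemma gradient_works:
  assumes "linear (differential At f p)"
  shows "g\<theta> p (gradient At T10 \<theta> f p) v = differential At f p v"
proof -
  have "\<exists>w. \<forall>v. g\<theta> p w v = differential At f p v"
    by (rule linear_functional_representation)
      (use assms linear_webster_metric linear_webster_metric2 webster_metric_pos[of _ p] in \<open>auto, force?\<close>)
  then obtain w where w: "\<forall>v. g\<theta> p w v = differential At f p v" by blast
  have "\<forall>v. g\<theta> p (gradient At T10 \<theta> f p) v = differential At f p v"
    unfolding gradient_def
  proof (rule theI[where a = w])
    fix w' assume "\<forall>v. g\<theta> p w' v = differential At f p v"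
    then have "g\<theta> p (w' - w) (w' - w) = 0"
      using w by (simp add: linear_diff[OF linear_webster_metric])
    then show "w' = w" using webster_metric_pos[of "w' - w" p] by force
  qed (rule w)
  then show ?thesis by blast
qed

lemma gradient_unique:
  assumes "\<And>v. g\<theta> p w v = differential At f p v"
  shows "gradient At T10 \<theta> f p = w"
proof -
  have "differential At f p = g\<theta> p w" using assms by auto
  then have "linear (differential At f p)" using linear_webster_metric2 by simp
  from gradient_works[OF this]
  have "g\<theta> p (gradient At T10 \<theta> f p - w) (gradient At T10 \<theta> f p - w) = 0"
    using assms by (simp add: linear_diff[OF linear_webster_metric])
  then show ?thesis using webster_metric_pos[of "gradient At T10 \<theta> f p - w" p] by force
qed

lemma gradient_compose:
  assumes f: "twice_differentiable_fun f"
    and g: "\<And>t. (g has_real_derivative g1 t) (at t)"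
    and g1: "\<And>t. (g1 has_real_derivative g2 t) (at t)"
  shows "gradient At T10 \<theta> (\<lambda>x. g (f x)) p = g1 (f p) *\<^sub>R gradient At T10 \<theta> f p"
  by (rule gradient_unique)
    (simp add: linear_cmul[OF linear_webster_metric] gradient_works[OF linear_differential[OF f]]
      twice_differentiable_fun_compose(2)[OF f g g1])

section \<open>The sub-Laplacian\<close>

definition basis_H :: "'a \<Rightarrow> (real^'n) set" where
  "basis_H p = (SOME B. orthonormal_basis_H At T10 \<theta> p B)"

lemma basis_H: "orthonormal_basis_H At T10 \<theta> p (basis_H p)"
  unfolding basis_H_def
proof (rule someI_ex)
  show "\<exists>B. orthonormal_basis_H At T10 \<theta> p B"
    unfolding orthonormal_basis_H_def
    by (rule orthonormal_basis_exists[OF subspace_H linear_webster_metric webster_metric_sym webster_metric_pos])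
qed

lemma sub_laplacian_eq:
  assumes "twice_differentiable_fun f"
  shows "sub_laplacian At T10 \<theta> nabla f p =
    (\<Sum>e\<in>basis_H p. second_differential f p e - differential At f p (nabla p e (coord_field At p e)))"
  unfolding sub_laplacian_def Let_def by (simp add: basis_H_def nabla_du_at_eq[OF assms])

text \<open>On \<open>H\<close> the differential is the inner product with the horizontal gradient,
  so this is Bessel's inequality. It controls the second-order term of
  \<open>sub_laplacian_compose\<close>.\<close>

lemma sum_differential_basis_H_le:
  assumes "linear (differential At f p)"
  shows "(\<Sum>e\<in>basis_H p. (differential At f p e)\<^sup>2) \<le> (norm\<theta> p (gradientH At T10 \<theta> f p))\<^sup>2"
proof -
  let ?h = "gradientH At T10 \<theta> f p"
  have B: "finite (basis_H p)" "\<And>e e'. e \<in> basis_H p \<Longrightarrow> e' \<in> basis_H p \<Longrightarrow> g\<theta> p e e' = (if e = e' then 1 else 0)"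
    "\<And>e. e \<in> basis_H p \<Longrightarrow> e \<in> H p"
    using basis_H[of p] span_base by (auto simp: orthonormal_basis_H_def)
  have "g\<theta> p ?h e = differential At f p e" if "e \<in> H p" for e
  proof -
    have "g\<theta> p ?h e = g\<theta> p (gradient At T10 \<theta> f p) e"
      using that piH_mem[of p] by (simp add: webster_metric_def gradientH_def piH_id mem_H_iff)
    then show ?thesis by (simp add: gradient_works[OF assms])
  qed
  then have "(\<Sum>e\<in>basis_H p. (differential At f p e)\<^sup>2) = (\<Sum>e\<in>basis_H p. (g\<theta> p ?h e)\<^sup>2)"
    using B(3) by (intro sum.cong) auto
  also have "\<dots> \<le> g\<theta> p ?h ?h"
    by (rule Bessel_inequality[OF linear_webster_metric webster_metric_sym webster_metric_nonneg B(1,2)])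
  finally show ?thesis by (simp add: webster_norm_def webster_metric_nonneg)
qed

text \<open>The connection term is linear in the differential and just picks up the factor
  \<open>g1\<close>; the term with \<open>g2\<close> comes from the coordinate Hessian
  alone.\<close>

lemma sub_laplacian_compose:
  assumes f: "twice_differentiable_fun f"
    and g: "\<And>t. (g has_real_derivative g1 t) (at t)"
    and g1: "\<And>t. (g1 has_real_derivative g2 t) (at t)"
  shows "sub_laplacian At T10 \<theta> nabla (\<lambda>x. g (f x)) p = g1 (f p) * sub_laplacian At T10 \<theta> nabla f p
      + g2 (f p) * (\<Sum>e\<in>basis_H p. (differential At f p e)\<^sup>2)"
  unfolding sub_laplacian_eq[OF f] sub_laplacian_eq[OF twice_differentiable_fun_compose(1)[OF f g g1]]
    twice_differentiable_fun_compose(2,3)[OF f g g1] sum_distrib_left sum.distrib[symmetric]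
  by (rule sum.cong) (auto simp: algebra_simps)

text \<open>At \<open>p\<close> the differentials agree, hence so do the connection terms, and the
  coordinate Hessians are compared summand by summand.\<close>

lemma sub_laplacian_maximum_of_difference:
  assumes f: "twice_differentiable_fun f" and h: "twice_differentiable_fun h"
    and max: "\<And>x. f x - h x \<le> f p - h p"
  shows "gradient At T10 \<theta> f p = gradient At T10 \<theta> h p"
    and "sub_laplacian At T10 \<theta> nabla f p \<le> sub_laplacian At T10 \<theta> nabla h p"
proof -
  note m = maximum_of_difference_fun[OF f h max]
  show "gradient At T10 \<theta> f p = gradient At T10 \<theta> h p"
    by (simp add: gradient_def m(1))
  show "sub_laplacian At T10 \<theta> nabla f p \<le> sub_laplacian At T10 \<theta> nabla h p"
    unfolding sub_laplacian_eq[OF f] sub_laplacian_eq[OF h] m(1)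
    by (intro sum_mono diff_right_mono m(2))
qed

end

section \<open>An Omori-Yau maximum principle\<close>

text \<open>The penalty \<open>\<delta> * \<Psi>\<close> makes a maximum exist; there the gradient
  of \<open>w\<close> equals that of the penalty, and its sub-Laplacian is at most that of the
  penalty. The maximum has to be kept outside \<open>K\<close>, where \<open>\<Psi>\<close> is
  controlled.\<close>

lemma (in pseudo_hermitian) Omori_Yau:
  assumes \<Psi>: "twice_differentiable_fun \<Psi>" and \<Psi>_nonneg: "\<And>x. \<Psi> x \<ge> 0"
    and \<Psi>_proper: "\<And>\<eta>::real. \<exists>K. compact K \<and> (\<forall>x. x \<notin> K \<longrightarrow> \<Psi> x > \<eta>)"
    and K: "compact K" and C: "C > 0"
    and \<Psi>_gradient: "\<And>x. x \<notin> K \<Longrightarrow> norm\<theta> x (gradient At T10 \<theta> \<Psi> x) \<le> C"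
    and \<Psi>_laplacian: "\<And>x. x \<notin> K \<Longrightarrow> sub_laplacian At T10 \<theta> nabla \<Psi> x \<le> C"
    and w: "twice_differentiable_fun w" and bdd: "bdd_above (range w)" and \<epsilon>: "\<epsilon> > 0"
  obtains x where "w x > (SUP x. w x) - \<epsilon>" "norm\<theta> x (gradient At T10 \<theta> w x) \<le> \<epsilon>"
    "sub_laplacian At T10 \<theta> nabla w x \<le> \<epsilon>"
proof -
  define s where "s = (SUP x. w x)"
  have ws: "w x \<le> s" for x unfolding s_def using bdd by (intro cSUP_upper) auto
  \<comment> \<open>The value \<open>\<delta> = 0\<close> is included: it settles the case of an
    attained supremum by comparing \<open>w\<close> with the zero function.\<close>
  have scale: "twice_differentiable_fun (\<lambda>x. \<delta> * \<Psi> x)"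
    "gradient At T10 \<theta> (\<lambda>x. \<delta> * \<Psi> x) x = \<delta> *\<^sub>R gradient At T10 \<theta> \<Psi> x"
    "sub_laplacian At T10 \<theta> nabla (\<lambda>x. \<delta> * \<Psi> x) x = \<delta> * sub_laplacian At T10 \<theta> nabla \<Psi> x" for \<delta> x
  proof -
    have d: "((*) \<delta> has_real_derivative \<delta>) (at t)" "((\<lambda>_. \<delta>) has_real_derivative 0) (at t)" for t
      by (auto intro!: derivative_eq_intros)
    show "twice_differentiable_fun (\<lambda>x. \<delta> * \<Psi> x)"
      "gradient At T10 \<theta> (\<lambda>x. \<delta> * \<Psi> x) x = \<delta> *\<^sub>R gradient At T10 \<theta> \<Psi> x"
      using twice_differentiable_fun_compose(1)[OF \<Psi> d] gradient_compose[OF \<Psi> d] by auto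
    show "sub_laplacian At T10 \<theta> nabla (\<lambda>x. \<delta> * \<Psi> x) x = \<delta> * sub_laplacian At T10 \<theta> nabla \<Psi> x"
      using sub_laplacian_compose[OF \<Psi> d] by simp
  qed
  show thesis
  proof (cases "\<exists>x. w x = s")
    case True
    then obtain x where x: "w x = s" by blast
    have max: "w y - 0 * \<Psi> y \<le> w x - 0 * \<Psi> x" for y using ws x by simp
    note m = sub_laplacian_maximum_of_difference[OF w scale(1) max]
    have "norm\<theta> x (gradient At T10 \<theta> w x) \<le> \<epsilon>"
      unfolding m(1) scale(2) using \<epsilon> by (simp add: webster_norm_scale del: scaleR_zero_left)
    moreover have "sub_laplacian At T10 \<theta> nabla w x \<le> \<epsilon>"
      using m(2)[of nabla] \<epsilon> unfolding scale(3) by simp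
    ultimately show thesis
      using that[of x] x \<epsilon> by (simp add: s_def)
  next
    case False
    then have less: "w x < s" for x using ws[of x] by (simp add: less_le)
    \<comment> \<open>An unattained supremum exceeds the maximum of \<open>w\<close> on the compact
      set \<open>K\<close>, so all points with \<open>w > \<mu>\<close> lie outside
      \<open>K\<close>.\<close>
    obtain \<mu> where \<mu>: "\<mu> < s" "s - \<epsilon> \<le> \<mu>" "\<And>x. x \<in> K \<Longrightarrow> w x \<le> \<mu>"
    proof (cases "K = {}")
      case True
      then show ?thesis using that[of "s - \<epsilon>"] \<epsilon> by auto
    next
      case False
      have "continuous_on K w"
        using continuous_twice_differentiable_fun[OF w] continuous_on_subset by blast
      from continuous_attains_sup[OF K False this] obtain z where "\<forall>x\<in>K. w x \<le> w z" by blast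
      then show ?thesis using that[of "max (w z) (s - \<epsilon>)"] less[of z] \<epsilon> by fastforce
    qed
    obtain y where y: "w y > \<mu>"
      using \<mu>(1) less_cSUP_iff[of UNIV w \<mu>] bdd unfolding s_def by auto
    \<comment> \<open>The first entry bounds the gradient and sub-Laplacian of the penalty by
      \<open>\<epsilon>\<close>; the second makes the penalty at \<open>y\<close> less than the gap
      \<open>w y - \<mu>\<close>. The summand 1 guards against \<open>\<Psi> y = 0\<close>.\<close>
    define \<delta> where "\<delta> = min (\<epsilon> / C) ((w y - \<mu>) / (2 * (\<Psi> y + 1)))"
    have \<delta>: "\<delta> > 0" "\<delta> * C \<le> \<epsilon>"
      using \<epsilon> C y \<Psi>_nonneg[of y] by (auto simp: \<delta>_def field_simps min_def)
    have "\<delta> * \<Psi> y \<le> (w y - \<mu>) / (2 * (\<Psi> y + 1)) * \<Psi> y"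
      using \<Psi>_nonneg[of y] by (intro mult_right_mono) (simp_all add: \<delta>_def)
    also have "\<dots> = (w y - \<mu>) * (\<Psi> y / (2 * (\<Psi> y + 1)))" by simp
    also have "\<dots> < (w y - \<mu>) * 1"
      using \<Psi>_nonneg[of y] y by (intro mult_strict_left_mono) auto
    finally have fy: "w y - \<delta> * \<Psi> y > \<mu>" by simp
    \<comment> \<open>Outside \<open>K'\<close> the penalized function is below its value at
      \<open>y\<close>, so its maximum over \<open>K'\<close> is global.\<close>
    obtain K' where K': "compact K'" "\<And>x. x \<notin> K' \<Longrightarrow> \<Psi> x > (s - (w y - \<delta> * \<Psi> y)) / \<delta>"
      using \<Psi>_proper by meson
    have outside: "w x - \<delta> * \<Psi> x < w y - \<delta> * \<Psi> y" if "x \<notin> K'" for x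
      using K'(2)[OF that] \<delta>(1) less[of x] by (simp add: field_simps)
    have cont: "continuous_on K' (\<lambda>x. w x - \<delta> * \<Psi> x)"
      using continuous_twice_differentiable_fun[OF w] continuous_twice_differentiable_fun[OF \<Psi>]
      by (intro continuous_intros) (auto intro: continuous_on_subset)
    have "y \<in> K'" using outside[of y] by auto
    then have "K' \<noteq> {}" by blast
    from continuous_attains_sup[OF K'(1) this cont]
    obtain x where x: "\<And>z. z \<in> K' \<Longrightarrow> w z - \<delta> * \<Psi> z \<le> w x - \<delta> * \<Psi> x" by blast
    have max: "w z - \<delta> * \<Psi> z \<le> w x - \<delta> * \<Psi> x" for z
      using x[of z] x[OF \<open>y \<in> K'\<close>] outside[of z] by (cases "z \<in> K'") auto
    note m = sub_laplacian_maximum_of_difference[OF w scale(1) max]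
    have "\<delta> * \<Psi> x \<ge> 0" using \<delta>(1) \<Psi>_nonneg[of x] by simp
    then have "w x \<ge> w y - \<delta> * \<Psi> y" using max[of y] by linarith
    then have wx: "w x > \<mu>" using fy by simp
    then have "x \<notin> K" using \<mu>(3)[of x] by auto
    from \<Psi>_gradient[OF this] \<Psi>_laplacian[OF this]
    have *: "\<delta> * norm\<theta> x (gradient At T10 \<theta> \<Psi> x) \<le> \<delta> * C" "\<delta> * sub_laplacian At T10 \<theta> nabla \<Psi> x \<le> \<delta> * C"
      using \<delta>(1) by (simp_all add: mult_left_mono)
    then have "norm\<theta> x (gradient At T10 \<theta> w x) \<le> \<epsilon>"
      unfolding m(1) scale(2) using order_trans[OF *(1) \<delta>(2)] \<delta>(1) by (simp add: webster_norm_scale)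
    moreover have "sub_laplacian At T10 \<theta> nabla w x \<le> \<epsilon>"
      using m(2)[of nabla] * \<delta>(2) unfolding scale(3) by simp
    ultimately show thesis
      using that[of x] wx \<mu>(2) by (simp add: s_def)
  qed
qed

section \<open>Integrability and primitives\<close>

lemma strict_mono_primitive:
  fixes g g1 :: "real \<Rightarrow> real"
  assumes "\<And>t. (g has_real_derivative g1 t) (at t)" "\<And>t. g1 t > 0"
  shows "strict_mono g"
proof (rule strict_monoI)
  fix x y :: real assume "x < y"
  then show "g x < g y" by (rule DERIV_pos_imp_increasing) (use assms in blast)
qed

text \<open>If \<open>g\<close> were bounded it would converge by monotonicity, and the fundamental
  theorem would give \<open>g1\<close> a finite integral over the half-line.\<close>

lemma unbounded_primitive:
  fixes g g1 h :: "real \<Rightarrow> real"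
  assumes g: "\<And>t. (g has_real_derivative g1 t) (at t)"
    and g1: "\<And>t. isCont g1 t" "\<And>t. g1 t > 0" "\<And>t. t \<ge> c \<Longrightarrow> g1 t = h t"
    and not_L1: "\<not> set_integrable lborel {c..} h"
  shows "\<exists>T. \<forall>t\<ge>T. g t > \<eta>"
proof (rule ccontr)
  assume contr: "\<nexists>T. \<forall>t\<ge>T. g t > \<eta>"
  have mono: "g x \<le> g y" if "x \<le> y" for x y
    using strict_mono_primitive[OF g g1(2)] that by (simp add: strict_mono_less_eq)
  have bound: "g t \<le> \<eta>" for t
  proof (rule ccontr)
    assume "\<not> g t \<le> \<eta>"
    then have "\<forall>s\<ge>t. g s > \<eta>" using mono by (meson not_le order_less_le_trans)
    then show False using contr by blast
  qed
  then have bdd: "bdd_above (range g)" by (intro bdd_aboveI2)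
  have lim: "(g \<longlongrightarrow> (SUP t. g t)) at_top"
  proof (rule increasing_tendsto)
    show "\<forall>\<^sub>F t in at_top. g t \<le> (SUP t. g t)" using bdd by (auto intro!: always_eventually cSUP_upper)
    fix x assume "x < (SUP t. g t)"
    then obtain t where "x < g t" using less_cSUP_iff[OF _ bdd] by auto
    then show "\<forall>\<^sub>F t in at_top. x < g t"
      using mono by (auto intro!: eventually_at_top_linorderI[of t] elim: order_less_le_trans)
  qed
  have meas: "g1 \<in> borel_measurable borel"
    using g1(1) by (intro borel_measurable_continuous_onI continuous_at_imp_continuous_on) auto
  have "(\<integral>\<^sup>+x. ennreal (g1 x) * indicator {c..} x \<partial>lborel) = (SUP t. g t) - g c"
    by (rule nn_integral_FTC_atLeast[OF meas g _ lim]) (use g1(2) in \<open>auto intro: less_imp_le\<close>)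
  moreover have "(\<integral>\<^sup>+x. ennreal (indicator {c..} x * g1 x) \<partial>lborel) =
      (\<integral>\<^sup>+x. ennreal (g1 x) * indicator {c..} x \<partial>lborel)"
    by (intro nn_integral_cong) (simp add: indicator_def)
  ultimately have "(\<integral>\<^sup>+x. ennreal (indicator {c..} x * g1 x) \<partial>lborel) < \<infinity>" by simp
  then have "integrable lborel (\<lambda>x. indicator {c..} x * g1 x)"
    using meas g1(2) by (intro integrableI_nonneg) (auto simp: less_imp_le)
  then have "set_integrable lborel {c..} g1" by (simp add: set_integrable_def)
  moreover have "set_integrable lborel {c..} g1 = set_integrable lborel {c..} h"
    using g1(3) by (intro set_integrable_cong) auto
  ultimately show False using not_L1 by simp
qed

text \<open>Beyond \<open>c\<close> the increment of \<open>g\<close> is part of a finite integral;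
  to the left of \<open>c\<close> monotonicity suffices.\<close>

lemma bounded_primitive:
  fixes g g1 h :: "real \<Rightarrow> real"
  assumes g: "\<And>t. (g has_real_derivative g1 t) (at t)"
    and g1: "\<And>t. isCont g1 t" "\<And>t. g1 t > 0" "\<And>t. t \<ge> c \<Longrightarrow> g1 t = h t"
    and L1: "set_integrable lborel {c..} h"
  shows "\<exists>C. \<forall>t. g t \<le> C"
proof -
  have "set_integrable lborel {c..} g1 = set_integrable lborel {c..} h"
    using g1(3) by (intro set_integrable_cong) auto
  then have int: "integrable lborel (\<lambda>x. g1 x * indicator {c..} x)"
    using L1 by (simp add: set_integrable_def mult.commute)
  define C where "C = (\<integral>x. g1 x * indicator {c..} x \<partial>lborel)"
  have mono: "g x \<le> g y" if "x \<le> y" for x y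
    using strict_mono_primitive[OF g g1(2)] that by (simp add: strict_mono_less_eq)
  have 1: "g t \<le> g c + C" if "c \<le> t" for t
  proof -
    have "(\<integral>x. g1 x * indicator {c..t} x \<partial>lborel) = g t - g c"
      by (rule integral_FTC_Icc_real[OF that g g1(1)])
    moreover have "(\<integral>x. g1 x * indicator {c..t} x \<partial>lborel) \<le> C"
      unfolding C_def
    proof (rule integral_mono_AE'[OF int])
      show "AE x in lborel. g1 x * indicator {c..t} x \<le> g1 x * indicator {c..} x"
        using g1(2) by (auto simp: indicator_def intro: less_imp_le)
      show "AE x in lborel. 0 \<le> g1 x * indicator {c..} x"
        using g1(2) by (auto simp: indicator_def intro: less_imp_le)
    qed
    ultimately show ?thesis by simp
  qed
  have "g t \<le> g c + C" for t
    using 1[of t] 1[of c] mono[of t c] by (cases "c \<le> t") auto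
  then show ?thesis by blast
qed

section \<open>Convexity of the nonlinearity\<close>

lemma partial_eq_frechet_derivative:
  fixes \<Phi> :: "real \<times> real \<Rightarrow> real"
  assumes "\<Phi> differentiable (at (x1, x2))"
  shows "partial1 (\<lambda>a b. \<Phi> (a, b)) x1 x2 = frechet_derivative \<Phi> (at (x1, x2)) (1, 0)"
    and "partial2 (\<lambda>a b. \<Phi> (a, b)) x1 x2 = frechet_derivative \<Phi> (at (x1, x2)) (0, 1)"
  using has_real_derivative_along_line[of \<Phi> "(0, x2)" x1 "(1, 0)"]
    has_real_derivative_along_line[of \<Phi> "(x1, 0)" x2 "(0, 1)"] assms
  by (auto simp: partial1_def partial2_def intro!: DERIV_imp_deriv)

text \<open>Along the segment from the origin to \<open>(y1, y2)\<close> the second derivative is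
  the quadratic form of the Hessian. The slope is therefore nondecreasing, and the mean value
  theorem bounds the increment below by the initial slope.\<close>

lemma convex_tangent_plane:
  assumes C2: "Ck_on 2 (\<lambda>x::real \<times> real. h (fst x) (snd x)) UNIV"
    and hess: "\<And>x1 x2. positive_semidefinite (hessian2 h x1 x2)"
  shows "h y1 y2 \<ge> h 0 0 + y1 * partial1 h 0 0 + y2 * partial2 h 0 0"
proof -
  define \<Phi> where "\<Phi> x = h (fst x) (snd x)" for x
  define \<Phi>1 where "\<Phi>1 x = frechet_derivative \<Phi> (at x) (1, 0)" for x
  define \<Phi>2 where "\<Phi>2 x = frechet_derivative \<Phi> (at x) (0, 1)" for x
  have "twice_differentiable_on \<Phi> UNIV"
    using Ck_on_2_imp_twice_differentiable[OF C2] by (simp add: \<Phi>_def[abs_def])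
  then have d: "\<Phi> differentiable (at x)" "\<Phi>1 differentiable (at x)" "\<Phi>2 differentiable (at x)" for x
    unfolding twice_differentiable_on_def \<Phi>1_def[abs_def] \<Phi>2_def[abs_def] by blast+
  have h: "h = (\<lambda>a b. \<Phi> (a, b))" by (simp add: \<Phi>_def)
  have p1: "partial1 h = (\<lambda>a b. \<Phi>1 (a, b))" "partial2 h = (\<lambda>a b. \<Phi>2 (a, b))"
    by (intro ext; simp add: h partial_eq_frechet_derivative[OF d(1)] \<Phi>1_def \<Phi>2_def)+
  note p2 = partial_eq_frechet_derivative[OF d(2)] partial_eq_frechet_derivative[OF d(3)]
  have lin: "frechet_derivative F (at x) (y1, y2) =
      y1 * frechet_derivative F (at x) (1, 0) + y2 * frechet_derivative F (at x) (0, 1)"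
    if "F differentiable (at x)" for F :: "real \<times> real \<Rightarrow> real" and x
  proof -
    have l: "linear (frechet_derivative F (at x))" using linear_frechet_derivative[OF that] .
    have "(y1, y2) = y1 *\<^sub>R (1, 0) + y2 *\<^sub>R (0, 1)" by simp
    then show ?thesis by (simp only: linear_add[OF l] linear_cmul[OF l] real_scaleR_def)
  qed
  define y where "y = (y1, y2)"
  define k' where "k' t = y1 * \<Phi>1 (t *\<^sub>R y) + y2 * \<Phi>2 (t *\<^sub>R y)" for t
  define k'' where "k'' t = y1 * frechet_derivative \<Phi>1 (at (t *\<^sub>R y)) y + y2 * frechet_derivative \<Phi>2 (at (t *\<^sub>R y)) y" for t
  have k: "((\<lambda>t. \<Phi> (t *\<^sub>R y)) has_real_derivative k' t) (at t)" for t
    using has_real_derivative_along_line[of \<Phi> 0 t y] d(1) lin[OF d(1), of "t *\<^sub>R y"]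
    by (simp add: k'_def \<Phi>1_def \<Phi>2_def y_def)
  have k': "(k' has_real_derivative k'' t) (at t)" for t
    unfolding k'_def[abs_def] k''_def
    using has_real_derivative_along_line[of \<Phi>1 0 t y] has_real_derivative_along_line[of \<Phi>2 0 t y] d(2,3)
    by (intro DERIV_add DERIV_cmult) simp_all
  have k''_nonneg: "k'' t \<ge> 0" for t
  proof -
    let ?v = "vector [y1, y2] :: real^2"
    have "0 \<le> ?v \<bullet> (hessian2 h (t * y1) (t * y2) *v ?v)"
      using hess by (auto simp: positive_semidefinite_def)
    also have "\<dots> = k'' t"
      using lin[OF d(2), of "t *\<^sub>R y"] lin[OF d(3), of "t *\<^sub>R y"]
      by (simp add: hessian2_def p1 p2 k''_def y_def inner_vec_def matrix_vector_mult_def sum_2 algebra_simps)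
    finally show ?thesis .
  qed
  obtain z where z: "0 < z" "z < 1" "\<Phi> (1 *\<^sub>R y) - \<Phi> (0 *\<^sub>R y) = (1 - 0) * k' z"
    using MVT2[of 0 1 "\<lambda>t. \<Phi> (t *\<^sub>R y)" k'] k by auto
  have "k' 0 \<le> k' z"
    by (rule DERIV_nonneg_imp_nondecreasing) (use z k' k''_nonneg in \<open>auto intro: less_imp_le\<close>)
  moreover have "k' 0 = y1 * partial1 h 0 0 + y2 * partial2 h 0 0"
    by (simp add: k'_def p1 zero_prod_def)
  moreover have "\<Phi> (1 *\<^sub>R y) = h y1 y2" "\<Phi> (0 *\<^sub>R y) = h 0 0"
    by (simp_all add: \<Phi>_def y_def)
  ultimately show ?thesis using z(3) unfolding diff_zero mult_1 by linarith
qed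

section \<open>The exhaustion function\<close>

lemma eventually_less_of_Limsup:
  fixes X :: "real \<Rightarrow> real"
  assumes "Limsup at_top (\<lambda>t. ereal (X t)) < \<infinity>"
  obtains C where "C > 0" "\<forall>\<^sub>F t in at_top. X t \<le> C"
proof -
  from ereal_dense2[OF assms] obtain z where "Limsup at_top (\<lambda>t. ereal (X t)) < ereal z" by blast
  from Limsup_lessD[OF this] have "\<forall>\<^sub>F t in at_top. X t \<le> max z 1"
    by (rule eventually_mono) simp
  then show thesis by (intro that[of "max z 1"]) auto
qed

lemma eventually_greater_of_Liminf:
  fixes X :: "real \<Rightarrow> real"
  assumes "Liminf at_top (\<lambda>t. ereal (X t)) > y"
  obtains z where "y < ereal z" "\<forall>\<^sub>F t in at_top. X t > z"
proof -
  from ereal_dense2[OF assms] obtain z where z: "y < ereal z" "ereal z < Liminf at_top (\<lambda>t. ereal (X t))" by blast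
  from less_LiminfD[OF z(2)] show thesis using z(1) by (intro that) auto
qed

text \<open>The function \<open>\<psi>(\<gamma>)\<close> with \<open>\<psi>' = 1 / sqrt G\<close>
  meets the demands of \<open>Omori_Yau\<close>: non-integrability makes it proper, and the growth
  condition on \<open>G\<close> bounds its gradient and, with concavity of \<open>\<psi>\<close>,
  its sub-Laplacian.\<close>

lemma (in pseudo_hermitian) Omori_Yau_exhaustion:
  fixes \<gamma> :: "'a \<Rightarrow> real" and G :: "real \<Rightarrow> real"
  assumes \<gamma>: "twice_differentiable_fun \<gamma>" and \<gamma>_nonneg: "\<And>x. \<gamma> x \<ge> 0"
    and A: "A > 0" and B: "B > 0" and G_smooth: "smooth_halfline G"
    and proper: "\<forall>\<eta>>0. \<exists>K. compact K \<and> (\<forall>x. x \<notin> K \<longrightarrow> \<gamma> x > \<eta>)"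
    and grad: "\<exists>K. compact K \<and>
         (\<forall>x. x \<notin> K \<longrightarrow> norm\<theta> x (gradient At T10 \<theta> \<gamma> x) \<le> A * sqrt (\<gamma> x))"
    and lap: "\<exists>K. compact K \<and>
         (\<forall>x. x \<notin> K \<longrightarrow> sub_laplacian At T10 \<theta> nabla \<gamma> x \<le> B * sqrt (\<gamma> x) * sqrt (G (sqrt (\<gamma> x))))"
    and G0: "G 0 > 0" and G_mono: "\<forall>t\<ge>0. vector_derivative G (at t within {0..}) \<ge> 0"
    and G_not_L1: "\<not> (\<exists>c\<ge>0. set_integrable lborel {c..} (\<lambda>t. G t powr (-1/2)))"
    and G_limsup: "Limsup at_top (\<lambda>t. ereal (t * G (sqrt t) / G t)) < \<infinity>"
    and w: "twice_differentiable_fun w" and bdd: "bdd_above (range w)" and \<epsilon>: "\<epsilon> > 0"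
  shows "\<exists>x. w x > (SUP x. w x) - \<epsilon> \<and> norm\<theta> x (gradient At T10 \<theta> w x) \<le> \<epsilon> \<and>
    sub_laplacian At T10 \<theta> nabla w x \<le> \<epsilon>"
proof -
  from G_smooth obtain D where D0: "\<And>t. t \<ge> 0 \<Longrightarrow> D 0 t = G t"
    and D: "\<And>k t. t \<ge> 0 \<Longrightarrow> (D k has_real_derivative D (Suc k) t) (at t within {0..})"
    unfolding smooth_halfline_def by blast
  have G': "(G has_real_derivative D 1 t) (at t within {0..})" if "t \<ge> 0" for t
    using has_field_derivative_transform_within[OF D[of t 0], of 1 G] D0 that by simp
  have G'_nonneg: "D 1 t \<ge> 0" if "t \<ge> 0" for t
  proof -
    have "(G has_vector_derivative D 1 t) (at t within {0..})"
      using G'[OF that] by (simp add: has_real_derivative_iff_has_vector_derivative)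
    \<comment> \<open>Every point of the half-line is a limit point of it, so the one-sided
      derivative is unique and \<open>vector_derivative\<close> returns
      \<open>D 1 t\<close>.\<close>
    moreover have "{t<..<t + 1} \<subseteq> {0..}" using that by auto
    then have "at t within {0..} \<noteq> bot"
      using islimpt_subset[OF islimpt_greaterThanLessThan1[of t "t + 1"], of "{0..}"]
      by (simp add: trivial_limit_within)
    ultimately show ?thesis using G_mono that vector_derivative_within by fastforce
  qed
  have G_ge: "G t \<ge> G 0" if "t \<ge> 0" for t
  proof (cases "t = 0")
    case False
    have "\<exists>x. 0 < x \<and> x < t \<and> G t - G 0 = D 1 x * (t - 0)"
      using False that mvt_simple[of 0 t G "\<lambda>x. (*) (D 1 x)"] G'
      by (force simp: has_field_derivative_def intro: has_derivative_subset)
    then show ?thesis using G'_nonneg by (smt (verit) mult_nonneg_nonneg)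
  qed simp
  have G_pos: "G t > 0" if "t \<ge> 0" for t using G_ge[OF that] G0 by simp
  \<comment> \<open>As \<open>\<gamma>\<close> may vanish, \<open>\<psi>\<close> has to be twice
    differentiable across 0; its derivative is continued affinely to negative arguments.\<close>
  obtain \<psi> \<psi>1 \<psi>2 where \<psi>: "\<And>t. (\<psi> has_real_derivative \<psi>1 t) (at t)"
    and \<psi>1: "\<And>t. (\<psi>1 has_real_derivative \<psi>2 t) (at t)"
    and pos: "\<And>t. \<psi>1 t > 0" and neg: "\<And>t. \<psi>2 t \<le> 0"
    and eq: "\<And>t. t \<ge> 0 \<Longrightarrow> \<psi>1 t = G t powr (-1/2)" and \<psi>0: "\<psi> 0 = 0"
  proof (rule concave_primitive_exists[of 0 "\<lambda>t. G t powr (-1/2)" "\<lambda>t. (-1/2) * G t powr (-1/2 - 1) * D 1 t"])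
    fix t :: real assume t: "0 \<le> t"
    show "((\<lambda>t. G t powr (-1/2)) has_real_derivative (-1/2) * G t powr (-1/2 - 1) * D 1 t) (at t within {0..})"
      using has_real_derivative_powr[OF G_pos[OF t], of "-1/2"]
      by (rule DERIV_chain2[OF _ G'[OF t]])
    show "G t powr (-1/2) > 0" using G_pos[OF t] by simp
    show "(-1/2) * G t powr (-1/2 - 1) * D 1 t \<le> 0" using G'_nonneg[OF t] by simp
  qed blast
  have cont: "isCont \<psi>1 t" for t using \<psi>1 DERIV_isCont by blast
  have unbounded: "\<exists>T. \<forall>t\<ge>T. \<psi> t > \<eta>" for \<eta>
    by (rule unbounded_primitive[OF \<psi> cont pos eq]) (use G_not_L1 in auto)
  have mono: "strict_mono \<psi>" by (rule strict_mono_primitive[OF \<psi> pos])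
  obtain C0 where C0: "C0 > 0" "\<forall>\<^sub>F t in at_top. t * G (sqrt t) / G t \<le> C0"
    using eventually_less_of_Limsup[OF G_limsup] by blast
  then obtain t0 where t0: "\<And>t. t \<ge> t0 \<Longrightarrow> t * G (sqrt t) / G t \<le> C0"
    by (auto simp: eventually_at_top_linorder)
  obtain K1 where K1: "compact K1" "\<And>x. x \<notin> K1 \<Longrightarrow> norm\<theta> x (gradient At T10 \<theta> \<gamma> x) \<le> A * sqrt (\<gamma> x)"
    using grad by blast
  obtain K2 where K2: "compact K2"
    "\<And>x. x \<notin> K2 \<Longrightarrow> sub_laplacian At T10 \<theta> nabla \<gamma> x \<le> B * sqrt (\<gamma> x) * sqrt (G (sqrt (\<gamma> x)))"
    using lap by blast
  \<comment> \<open>Properness is given for positive levels, hence the maximum with 1; it also keeps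
    \<open>\<gamma>\<close> positive outside \<open>K3\<close>.\<close>
  obtain K3 where K3: "compact K3" "\<And>x. x \<notin> K3 \<Longrightarrow> \<gamma> x > max t0 1"
    using proper[rule_format, of "max t0 1"] less_max_iff_disj[of 0 t0 1] zero_less_one by blast
  define C where "C = max (A * sqrt (C0 / G 0)) (B * sqrt C0)"
  have root: "\<psi>1 t = 1 / sqrt (G t)" if "t \<ge> 0" for t
    using eq[OF that] G_pos[OF that] by (simp add: powr_minus_divide powr_half_sqrt)
  show ?thesis
  proof (rule Omori_Yau[of "\<lambda>x. \<psi> (\<gamma> x)" "K1 \<union> K2 \<union> K3" C nabla w \<epsilon>])
    show "twice_differentiable_fun (\<lambda>x. \<psi> (\<gamma> x))"
      by (rule twice_differentiable_fun_compose(1)[OF \<gamma> \<psi> \<psi>1])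
    show "\<psi> (\<gamma> x) \<ge> 0" for x
      using mono \<gamma>_nonneg[of x] \<psi>0 by (metis strict_mono_less_eq)
    show "\<exists>K. compact K \<and> (\<forall>x. x \<notin> K \<longrightarrow> \<psi> (\<gamma> x) > \<eta>)" for \<eta>
    proof -
      obtain T where T: "\<And>t. t \<ge> T \<Longrightarrow> \<psi> t > \<eta>" using unbounded by blast
      obtain K where "compact K" "\<And>x. x \<notin> K \<Longrightarrow> \<gamma> x > max T 1" 
        using proper[rule_format, of "max T 1"] less_max_iff_disj[of 0 T 1] zero_less_one by blast
      then show ?thesis using T by (intro exI[of _ K]) force
    qed
    show "compact (K1 \<union> K2 \<union> K3)" using K1 K2 K3 by blast
    show "C > 0" using A G0 C0 by (simp add: C_def less_max_iff_disj)
    fix x assume x: "x \<notin> K1 \<union> K2 \<union> K3"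
    define t where "t = \<gamma> x"
    have t: "t \<ge> t0" "t > 0" using K3(2)[of x] x by (auto simp: t_def)
    note G_t = G_pos[of t] G_pos[of "sqrt t"] G_ge[of "sqrt t"] t0[OF t(1)]
    \<comment> \<open>Since \<open>G (sqrt t) \<ge> G 0\<close>, the growth condition also bounds
      \<open>t / G t\<close>, which is what the gradient needs.\<close>
    have "t / G t * G 0 \<le> t / G t * G (sqrt t)"
      using G_t t by (intro mult_left_mono) auto
    also have "\<dots> \<le> C0" using G_t(4) by simp
    finally have "t / G t \<le> C0 / G 0"
      using G0 by (simp add: pos_le_divide_eq)
    then have 1: "sqrt t / sqrt (G t) \<le> sqrt (C0 / G 0)"
      unfolding real_sqrt_divide[symmetric] by (rule real_sqrt_le_mono)
    have 2: "sqrt t * sqrt (G (sqrt t)) / sqrt (G t) \<le> sqrt C0"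
      unfolding real_sqrt_divide[symmetric] real_sqrt_mult[symmetric] using G_t(4) by (rule real_sqrt_le_mono)
    have "norm\<theta> x (gradient At T10 \<theta> (\<lambda>x. \<psi> (\<gamma> x)) x) = \<psi>1 t * norm\<theta> x (gradient At T10 \<theta> \<gamma> x)"
      unfolding gradient_compose[OF \<gamma> \<psi> \<psi>1] webster_norm_scale using pos[of t] by (simp add: t_def)
    also have "\<dots> \<le> \<psi>1 t * (A * sqrt t)"
      using K1(2)[of x] x pos[of t] by (intro mult_left_mono) (auto simp: t_def)
    also have "\<dots> = A * (sqrt t / sqrt (G t))" using root[of t] t by simp
    also have "\<dots> \<le> A * sqrt (C0 / G 0)" using 1 A by (intro mult_left_mono) auto
    finally show "norm\<theta> x (gradient At T10 \<theta> (\<lambda>x. \<psi> (\<gamma> x)) x) \<le> C" by (simp add: C_def)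
    \<comment> \<open>The term with \<open>\<psi>2 \<le> 0\<close> has the favorable sign and is
      dropped.\<close>
    have "sub_laplacian At T10 \<theta> nabla (\<lambda>x. \<psi> (\<gamma> x)) x \<le> \<psi>1 t * sub_laplacian At T10 \<theta> nabla \<gamma> x"
      unfolding sub_laplacian_compose[OF \<gamma> \<psi> \<psi>1]
      using neg[of t] by (simp add: t_def mult_nonpos_nonneg sum_nonneg)
    also have "\<dots> \<le> \<psi>1 t * (B * sqrt t * sqrt (G (sqrt t)))"
      using K2(2)[of x] x pos[of t] by (intro mult_left_mono) (auto simp: t_def)
    also have "\<dots> = B * (sqrt t * sqrt (G (sqrt t)) / sqrt (G t))" using root[of t] t by simp
    also have "\<dots> \<le> B * sqrt C0" using 2 B by (intro mult_left_mono) auto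
    finally show "sub_laplacian At T10 \<theta> nabla (\<lambda>x. \<psi> (\<gamma> x)) x \<le> C" by (simp add: C_def)
  qed (use w bdd \<epsilon> in auto)
qed

section \<open>A Keller-Osserman estimate\<close>

lemma primitive_of_positive:
  fixes F :: "real \<Rightarrow> real"
  assumes F: "continuous_on UNIV F" and pos: "\<And>t. t \<ge> a \<Longrightarrow> F t > 0" and t: "t > a"
  shows "((\<lambda>x. integral {a..x} F) has_real_derivative F t) (at t)" and "integral {a..t} F > 0"
proof -
  have F': "continuous_on S F" for S using F continuous_on_subset by blast
  have d: "((\<lambda>x. integral {a..x} F) has_real_derivative F s) (at s)" if "s > a" for s
    using integral_has_real_derivative[OF F', of s a "s + 1"] that
      at_within_Icc_at[of a s "s + 1"] by simp
  show "((\<lambda>x. integral {a..x} F) has_real_derivative F t) (at t)" by (rule d[OF t])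
  have "integral {a..a} F < integral {a..t} F"
  proof (rule DERIV_pos_imp_increasing_open[OF t])
    show "\<And>x. a < x \<Longrightarrow> x < t \<Longrightarrow> \<exists>y. ((\<lambda>x. integral {a..x} F) has_real_derivative y) (at x) \<and> y > 0"
      using d pos by (meson less_imp_le)
    show "continuous_on {a..t} (\<lambda>x. integral {a..x} F)"
      by (intro indefinite_integral_continuous_1 integrable_continuous_real F')
  qed
  then show "integral {a..t} F > 0" by simp
qed

text \<open>With \<open>I\<close> the primitive of \<open>F\<close>, a near-maximum of
  \<open>g(u)\<close> with \<open>g' = 1 / sqrt I\<close> yields \<open>F / sqrt I * (c - 2 * D *
  \<epsilon> - \<epsilon>\<^sup>2 / 2) \<le> \<epsilon>\<close>, against a positive lower bound for
  \<open>F / sqrt I\<close>.\<close>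

lemma (in pseudo_hermitian) bounded_above:
  fixes u :: "'a \<Rightarrow> real" and \<phi> :: "real \<Rightarrow> real \<Rightarrow> real \<Rightarrow> real"
  assumes OY: "\<And>w \<epsilon>. twice_differentiable_fun w \<Longrightarrow> bdd_above (range w) \<Longrightarrow> \<epsilon> > 0 \<Longrightarrow>
      \<exists>x. w x > (SUP x. w x) - \<epsilon> \<and> norm\<theta> x (gradient At T10 \<theta> w x) \<le> \<epsilon> \<and>
        sub_laplacian At T10 \<theta> nabla w x \<le> \<epsilon>"
    and u: "twice_differentiable_fun u"
    and u_ineq: "\<And>x. sub_laplacian At T10 \<theta> nabla u x \<ge>
         \<phi> (u x) (norm\<theta> x (gradientL At T10 \<theta> u x)) (norm\<theta> x (gradientH At T10 \<theta> u x))"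
    and tangent: "\<And>t y1 y2. \<phi> t y1 y2 \<ge> \<phi> t 0 0 + y1 * partial1 (\<phi> t) 0 0 + y2 * partial2 (\<phi> t) 0 0"
    and F: "continuous_on UNIV F" and F_pos: "\<And>t. t \<ge> a \<Longrightarrow> F t > 0"
    and F_int: "\<exists>b>a. set_integrable lborel {b..} (\<lambda>t. (integral {a..t} F) powr (-1/2))"
    and F_limsup: "Limsup at_top (\<lambda>t. ereal (integral {a..t} F / (t * F t))) < \<infinity>"
    and liminf1: "Liminf at_top (\<lambda>t. ereal (sqrt (integral {a..t} F) / F t * partial1 (\<phi> t) 0 0)) > -\<infinity>"
    and liminf2: "Liminf at_top (\<lambda>t. ereal (sqrt (integral {a..t} F) / F t * partial2 (\<phi> t) 0 0)) > -\<infinity>"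
    and f: "Liminf at_top (\<lambda>t. ereal (\<phi> t 0 0 / F t)) > 0"
  shows "bdd_above (range u)"
proof (rule ccontr)
  assume "\<not> bdd_above (range u)"
  then have unbounded: "\<exists>x. u x > r" for r by (meson bdd_aboveI2 not_le)
  define I where "I t = integral {a..t} F" for t
  obtain b where b: "b > a" "set_integrable lborel {b..} (\<lambda>t. I t powr (-1/2))"
    using F_int by (auto simp: I_def)
  obtain C2 where C2: "C2 > 0" "\<forall>\<^sub>F t in at_top. I t / (t * F t) \<le> C2"
    using eventually_less_of_Limsup[OF F_limsup] unfolding I_def by blast
  obtain d1 where d1: "\<forall>\<^sub>F t in at_top. sqrt (I t) / F t * partial1 (\<phi> t) 0 0 > d1"
    using eventually_greater_of_Liminf[OF liminf1] unfolding I_def by blast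
  obtain d2 where d2: "\<forall>\<^sub>F t in at_top. sqrt (I t) / F t * partial2 (\<phi> t) 0 0 > d2"
    using eventually_greater_of_Liminf[OF liminf2] unfolding I_def by blast
  obtain c where c: "c > 0" "\<forall>\<^sub>F t in at_top. \<phi> t 0 0 / F t > c"
    using eventually_greater_of_Liminf[OF f] by auto
  \<comment> \<open>One nonnegative constant such that both slopes of \<open>\<phi>\<close> are at
    least \<open>- D * F / sqrt I\<close> for large \<open>t\<close>.\<close>
  define D where "D = max 0 (max (- d1) (- d2))"
  have "\<forall>\<^sub>F t in at_top. I t / (t * F t) \<le> C2 \<and> sqrt (I t) / F t * partial1 (\<phi> t) 0 0 > d1 \<and>
      sqrt (I t) / F t * partial2 (\<phi> t) 0 0 > d2 \<and> \<phi> t 0 0 / F t > c"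
    using C2(2) d1 d2 c(2) by eventually_elim auto
  then obtain T0 where T0: "\<And>t. t \<ge> T0 \<Longrightarrow> I t / (t * F t) \<le> C2 \<and>
      sqrt (I t) / F t * partial1 (\<phi> t) 0 0 > d1 \<and>
      sqrt (I t) / F t * partial2 (\<phi> t) 0 0 > d2 \<and> \<phi> t 0 0 / F t > c"
    by (auto simp: eventually_at_top_linorder)
  \<comment> \<open>Beyond \<open>T0\<close> the asymptotic bounds hold, beyond \<open>b\<close> the
    integrability, and \<open>b > a\<close> makes \<open>I\<close> positive; the 1 makes
    \<open>T\<close> positive.\<close>
  define T where "T = max T0 (max b 1)"
  have T: "T \<ge> T0" "T \<ge> b" "T > a" "T > 0" using b(1) by (auto simp: T_def)
  have I': "(I has_real_derivative F t) (at t)" and I_pos: "I t > 0" if "t \<ge> T" for t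
    using primitive_of_positive[OF F F_pos, of a t] that T unfolding I_def[abs_def] by auto
  obtain g g1 g2 where g: "\<And>t. (g has_real_derivative g1 t) (at t)"
    and g1: "\<And>t. (g1 has_real_derivative g2 t) (at t)"
    and pos: "\<And>t. g1 t > 0" and neg: "\<And>t. g2 t \<le> 0"
    and eq1: "\<And>t. t \<ge> T \<Longrightarrow> g1 t = I t powr (-1/2)"
    and eq2: "\<And>t. t \<ge> T \<Longrightarrow> g2 t = (-1/2) * I t powr (-1/2 - 1) * F t" and g0: "g T = 0"
  proof (rule concave_primitive_exists[of T "\<lambda>t. I t powr (-1/2)" "\<lambda>t. (-1/2) * I t powr (-1/2 - 1) * F t"])
    fix t :: real assume t: "T \<le> t"
    have "((\<lambda>t. I t powr (-1/2)) has_real_derivative (-1/2) * I t powr (-1/2 - 1) * F t) (at t)"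
      using has_real_derivative_powr[OF I_pos[OF t], of "-1/2"]
      by (rule DERIV_chain2[OF _ I'[OF t]])
    then show "((\<lambda>t. I t powr (-1/2)) has_real_derivative (-1/2) * I t powr (-1/2 - 1) * F t) (at t within {T..})"
      by (rule has_field_derivative_at_within)
    show "I t powr (-1/2) > 0" using I_pos[OF t] by simp
    show "(-1/2) * I t powr (-1/2 - 1) * F t \<le> 0" using F_pos[of t] T t by simp
  qed blast
  have cont: "isCont g1 t" for t using g1 DERIV_isCont by blast
  have "set_integrable lborel {T..} (\<lambda>t. I t powr (-1/2))"
    by (rule set_integrable_subset[OF b(2)]) (use T in auto)
  from bounded_primitive[OF g cont pos eq1 this]
  obtain C where C: "\<And>t. g t \<le> C" by blast
  have mono: "strict_mono g" by (rule strict_mono_primitive[OF g pos])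
  have C_pos: "C > 0" using C[of "T + 1"] strict_monoD[OF mono, of T "T + 1"] g0 by simp
  have root: "g1 t = 1 / sqrt (I t)" "g2 t = - F t / (2 * sqrt (I t) ^ 3)" if "t \<ge> T" for t
  proof -
    have "I t powr (-1/2 - 1) = I t powr (-1/2) / I t"
      using I_pos[OF that] by (simp only: powr_diff powr_one)
    then show "g1 t = 1 / sqrt (I t)" "g2 t = - F t / (2 * sqrt (I t) ^ 3)"
      using eq1[OF that] eq2[OF that] I_pos[OF that]
      by (simp_all add: powr_minus_divide powr_half_sqrt power3_eq_cube)
  qed
  (* The concavity of g turns its boundedness into growth of the square root of I. *)
  have growth: "sqrt (I t) \<ge> t / (2 * C)" if t: "t \<ge> 2 * T" for t
  proof -
    have tT: "t > T" using t T by simp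
    obtain z where z: "T < z" "z < t" "g t - g T = (t - T) * g1 z"
      using MVT2[OF tT g] by blast
    have "g1 t \<le> g1 z"
      using DERIV_nonpos_imp_nonincreasing[of z t g1] z g1 neg by (meson less_imp_le)
    \<comment> \<open>Here \<open>t \<ge> 2 * T\<close> is used as
      \<open>t / 2 \<le> t - T\<close>.\<close>
    then have "(t / 2) * g1 t \<le> (t - T) * g1 z"
      using t tT pos[of t] T by (intro mult_mono) (auto intro: less_imp_le)
    then have "t / 2 * g1 t \<le> C" using z(3) g0 C[of t] by simp
    then show ?thesis using root(1)[of t] I_pos[of t] tT C_pos by (simp add: field_simps)
  qed
  define \<kappa> where "\<kappa> = 1 / (2 * C * C2)"
  have \<kappa>: "\<kappa> > 0" using C_pos C2(1) by (simp add: \<kappa>_def)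
  \<comment> \<open>Write the quotient as \<open>(F / I) * sqrt I\<close>: the first factor is at
    least \<open>1 / (C2 * t)\<close>, the second at least \<open>t / (2 * C)\<close>.\<close>
  have ratio: "F t / sqrt (I t) \<ge> \<kappa>" if t: "t \<ge> 2 * T" for t
  proof -
    have tT: "t \<ge> T" "t > 0" "F t > 0" "I t > 0" "t \<ge> T0"
      using t T F_pos[of t] I_pos[of t] by auto
    have "I t \<le> C2 * (t * F t)" using T0[of t] tT by (simp add: pos_divide_le_eq)
    moreover have "I t = sqrt (I t) * sqrt (I t)" using tT by simp
    ultimately have "sqrt (I t) \<le> C2 * t * (F t / sqrt (I t))"
      using tT by (simp add: field_simps)
    then have "t * (1 / (2 * C)) \<le> t * (C2 * (F t / sqrt (I t)))"
      using growth[OF t] by (simp add: mult_ac)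
    then have "1 / (2 * C) \<le> C2 * (F t / sqrt (I t))"
      using tT(2) by (rule mult_left_le_imp_le)
    then show ?thesis using C_pos C2(1) by (simp add: \<kappa>_def field_simps)
  qed
  have w: "twice_differentiable_fun (\<lambda>x. g (u x))"
    by (rule twice_differentiable_fun_compose(1)[OF u g g1])
  have bdd: "bdd_above (range (\<lambda>x. g (u x)))" using C by (intro bdd_aboveI2)
  obtain y where y: "u y > 2 * T" using unbounded by blast
  \<comment> \<open>In order, the entries give \<open>\<epsilon>\<^sup>2 \<le> \<epsilon>\<close>,
    keep the final factor at least \<open>c / 2\<close>, contradict
    \<open>\<kappa> * (c / 2) \<le> \<epsilon>\<close>, and force
    \<open>u x > 2 * T\<close>.\<close>
  define \<epsilon> where "\<epsilon> = Min {1, c / (2 * (2 * D + 1)), \<kappa> * c / 4, g (u y) - g (2 * T)}"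
  have D: "D \<ge> 0" "D \<ge> - d1" "D \<ge> - d2" by (auto simp: D_def)
  have \<epsilon>0: "\<epsilon> > 0"
    unfolding \<epsilon>_def using c(1) D \<kappa> strict_monoD[OF mono y] by (subst Min_gr_iff) auto
  have \<epsilon>_le: "\<epsilon> \<le> 1" "\<epsilon> \<le> c / (2 * (2 * D + 1))" "\<epsilon> \<le> \<kappa> * c / 4" "\<epsilon> \<le> g (u y) - g (2 * T)"
    unfolding \<epsilon>_def by (rule Min_le; simp)+
  note \<epsilon> = \<epsilon>0 \<epsilon>_le
  from OY[OF w bdd \<epsilon>(1)] obtain x where x: "g (u x) > (SUP x. g (u x)) - \<epsilon>"
    "norm\<theta> x (gradient At T10 \<theta> (\<lambda>x. g (u x)) x) \<le> \<epsilon>"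
    "sub_laplacian At T10 \<theta> nabla (\<lambda>x. g (u x)) x \<le> \<epsilon>" by blast
  define t where "t = u x"
  have "g (u y) \<le> (SUP x. g (u x))" using bdd by (intro cSUP_upper) auto
  then have "g t > g (2 * T)" using x(1) \<epsilon>(5) by (simp add: t_def)
  then have t: "t \<ge> 2 * T" "t \<ge> T" "t \<ge> T0" "t > 0" "t \<ge> a"
    using mono T by (auto simp: strict_mono_less)
  define Q N nL nH where "Q = sqrt (I t)" and "N = norm\<theta> x (gradient At T10 \<theta> u x)"
    and "nL = norm\<theta> x (gradientL At T10 \<theta> u x)" and "nH = norm\<theta> x (gradientH At T10 \<theta> u x)"
  have Q: "Q > 0" using I_pos[OF t(2)] by (simp add: Q_def)
  have Ft: "F t > 0" using F_pos t by simp
  have n: "0 \<le> nL" "nL \<le> N" "0 \<le> nH" "nH \<le> N"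
    using webster_norm_nonneg webster_norm_piL_le webster_norm_piH_le
    by (auto simp: nL_def nH_def N_def gradientL_def gradientH_def)
  \<comment> \<open>The gradient of \<open>g(u)\<close> is \<open>1 / Q\<close> times that of
    \<open>u\<close>.\<close>
  have N: "N \<le> \<epsilon> * Q"
    using x(2) Q root(1)[OF t(2)] pos[of t]
    unfolding gradient_compose[OF u g g1] webster_norm_scale
    by (simp add: t_def[symmetric] N_def[symmetric] Q_def[symmetric] field_simps)
  have p: "partial1 (\<phi> t) 0 0 \<ge> - D * F t / Q" "partial2 (\<phi> t) 0 0 \<ge> - D * F t / Q" "\<phi> t 0 0 \<ge> c * F t"
  proof -
    have "Q / F t * partial1 (\<phi> t) 0 0 \<ge> - D" "Q / F t * partial2 (\<phi> t) 0 0 \<ge> - D" "\<phi> t 0 0 / F t \<ge> c"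
      using T0[OF t(3)] D by (auto simp: Q_def)
    then show "partial1 (\<phi> t) 0 0 \<ge> - D * F t / Q" "partial2 (\<phi> t) 0 0 \<ge> - D * F t / Q" "\<phi> t 0 0 \<ge> c * F t"
      using Q Ft by (simp_all add: field_simps)
  qed
  \<comment> \<open>The factor \<open>Q\<close> in the bound for the gradient cancels the
    \<open>1 / Q\<close> in the lower bound for the slope.\<close>
  have grad: "s * q \<ge> - (D * F t * \<epsilon>)" if s: "0 \<le> s" "s \<le> N" and q: "q \<ge> - D * F t / Q" for s q
  proof -
    have "s * q \<ge> s * (- D * F t / Q)" using s q by (intro mult_left_mono) auto
    moreover have "s * (D * F t / Q) \<le> \<epsilon> * Q * (D * F t / Q)"
      using s N D(1) Ft Q by (intro mult_right_mono) auto
    ultimately show ?thesis using Q by (simp add: mult.commute mult.left_commute)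
  qed
  have "\<phi> t nL nH \<ge> c * F t - 2 * D * F t * \<epsilon>"
    using tangent[of t nL nH] p(3) grad[OF n(1,2) p(1)] grad[OF n(3,4) p(2)] by simp
  then have "sub_laplacian At T10 \<theta> nabla u x \<ge> F t * (c - 2 * D * \<epsilon>)"
    using u_ineq[of x] by (simp add: t_def nL_def nH_def algebra_simps)
  then have 1: "g1 t * sub_laplacian At T10 \<theta> nabla u x \<ge> g1 t * (F t * (c - 2 * D * \<epsilon>))"
    using pos[of t] by (intro mult_left_mono) auto
  have "(\<Sum>e\<in>basis_H x. (differential At u x e)\<^sup>2) \<le> nH\<^sup>2"
    using sum_differential_basis_H_le[OF linear_differential[OF u]] by (simp add: nH_def)
  also have "\<dots> \<le> (\<epsilon> * Q)\<^sup>2" using n N by (intro power_mono) auto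
  \<comment> \<open>Because \<open>g2 t \<le> 0\<close>, the upper bound for the squares becomes a
    lower bound.\<close>
  finally have "g2 t * (\<Sum>e\<in>basis_H x. (differential At u x e)\<^sup>2) \<ge> g2 t * (\<epsilon> * Q)\<^sup>2"
    using neg[of t] by (intro mult_left_mono_neg)
  with 1 have "sub_laplacian At T10 \<theta> nabla (\<lambda>x. g (u x)) x \<ge> g1 t * (F t * (c - 2 * D * \<epsilon>)) + g2 t * (\<epsilon> * Q)\<^sup>2"
    unfolding sub_laplacian_compose[OF u g g1] by (simp add: t_def)
  also have "g1 t * (F t * (c - 2 * D * \<epsilon>)) + g2 t * (\<epsilon> * Q)\<^sup>2 = F t / Q * (c - 2 * D * \<epsilon> - \<epsilon>\<^sup>2 / 2)"
    unfolding root[OF t(2)] Q_def[symmetric] using Q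
    by (simp add: field_simps power2_eq_square power3_eq_cube)
  finally have "F t / Q * (c - 2 * D * \<epsilon> - \<epsilon>\<^sup>2 / 2) \<le> \<epsilon>" using x(3) by simp
  moreover have "c - 2 * D * \<epsilon> - \<epsilon>\<^sup>2 / 2 \<ge> c / 2"
  proof -
    have "\<epsilon> * (2 * D + 1) \<le> c / 2" using \<epsilon>(3) D(1) by (simp add: field_simps)
    moreover have "\<epsilon>\<^sup>2 \<le> \<epsilon>" using \<epsilon>(1,2) by (simp add: power2_eq_square mult_left_le)
    ultimately show ?thesis using \<epsilon>(1) by (simp add: algebra_simps)
  qed
  moreover have "\<kappa> * (c / 2) \<le> F t / Q * (c - 2 * D * \<epsilon> - \<epsilon>\<^sup>2 / 2)"
    using ratio[OF t(1)] calculation(2) c(1) \<kappa> Ft Q by (intro mult_mono) (auto simp: Q_def)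
  ultimately have "\<kappa> * (c / 2) \<le> \<epsilon>" by linarith
  moreover have "\<kappa> * c > 0" using \<kappa> c(1) by simp
  ultimately show False using \<epsilon>(4) by simp
qed

text \<open>Along almost maximal points the values of \<open>u\<close> tend to the supremum while
  the gradient norms tend to 0; the differential inequality passes to the limit by continuity of
  \<open>\<phi>\<close> in \<open>t\<close>.\<close>

lemma (in pseudo_hermitian) f_sup_nonpos:
  fixes u :: "'a \<Rightarrow> real" and \<phi> :: "real \<Rightarrow> real \<Rightarrow> real \<Rightarrow> real"
  assumes OY: "\<And>\<epsilon>. \<epsilon> > 0 \<Longrightarrow>
      \<exists>x. u x > (SUP x. u x) - \<epsilon> \<and> norm\<theta> x (gradient At T10 \<theta> u x) \<le> \<epsilon> \<and>
        sub_laplacian At T10 \<theta> nabla u x \<le> \<epsilon>"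
    and bdd: "bdd_above (range u)"
    and u_ineq: "\<And>x. sub_laplacian At T10 \<theta> nabla u x \<ge>
         \<phi> (u x) (norm\<theta> x (gradientL At T10 \<theta> u x)) (norm\<theta> x (gradientH At T10 \<theta> u x))"
    and tangent: "\<And>t y1 y2. \<phi> t y1 y2 \<ge> \<phi> t 0 0 + y1 * partial1 (\<phi> t) 0 0 + y2 * partial2 (\<phi> t) 0 0"
    and cont: "\<And>x1 x2. continuous_on UNIV (\<lambda>t. \<phi> t x1 x2)"
  shows "\<phi> (SUP x. u x) 0 0 \<le> 0"
proof -
  define s where "s = (SUP x. u x)"
  define \<beta> where "\<beta> t = \<bar>\<phi> t 0 0 - \<phi> t (-1) 0\<bar> + \<bar>\<phi> t 0 0 - \<phi> t 0 (-1)\<bar>" for t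
  (* By convexity the slopes of phi at the origin are bounded below by difference quotients,
     which are continuous in t although the slopes themselves need not be. *)
  have slope: "partial1 (\<phi> t) 0 0 \<ge> - \<beta> t" "partial2 (\<phi> t) 0 0 \<ge> - \<beta> t" for t
    using tangent[of t "-1" 0] tangent[of t 0 "-1"] by (auto simp: \<beta>_def)
  have "\<forall>n::nat. \<exists>x. u x > s - inverse (Suc n) \<and> norm\<theta> x (gradient At T10 \<theta> u x) \<le> inverse (Suc n) \<and>
        sub_laplacian At T10 \<theta> nabla u x \<le> inverse (Suc n)"
    using OY by (simp add: s_def)
  then obtain X where X: "\<And>n. u (X n) > s - inverse (Suc n)"
    "\<And>n. norm\<theta> (X n) (gradient At T10 \<theta> u (X n)) \<le> inverse (Suc n)"
    "\<And>n. sub_laplacian At T10 \<theta> nabla u (X n) \<le> inverse (Suc n)" by metis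
  have us: "u (X n) \<le> s" for n unfolding s_def using bdd by (intro cSUP_upper) auto
  have inv: "(\<lambda>n. inverse (real (Suc n))) \<longlonglongrightarrow> 0" by (rule LIMSEQ_inverse_real_of_nat)
  have lim: "(\<lambda>n. u (X n)) \<longlonglongrightarrow> s"
  proof (rule tendsto_sandwich[of "\<lambda>n. s - inverse (real (Suc n))" _ _ "\<lambda>_. s"])
    show "(\<lambda>n. s - inverse (real (Suc n))) \<longlonglongrightarrow> s" using tendsto_diff[OF tendsto_const inv, of s] by simp
  qed (use X(1) us in \<open>auto intro!: always_eventually less_imp_le\<close>)
  have ineq: "\<phi> (u (X n)) 0 0 - 2 * \<beta> (u (X n)) * inverse (Suc n) \<le> inverse (Suc n)" for n
  proof -
    define x t e where "x = X n" and "t = u (X n)" and "e = inverse (real (Suc n))"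
    define nL nH where "nL = norm\<theta> x (gradientL At T10 \<theta> u x)" and "nH = norm\<theta> x (gradientH At T10 \<theta> u x)"
    have n: "0 \<le> nL" "nL \<le> e" "0 \<le> nH" "nH \<le> e"
      using webster_norm_nonneg order_trans[OF webster_norm_piL_le X(2)] order_trans[OF webster_norm_piH_le X(2)]
      by (auto simp: nL_def nH_def x_def e_def gradientL_def gradientH_def)
    have \<beta>: "\<beta> t \<ge> 0" by (simp add: \<beta>_def)
    have est: "r * q \<ge> - (\<beta> t * e)" if "0 \<le> r" "r \<le> e" "q \<ge> - \<beta> t" for r q
    proof -
      have "r * q \<ge> r * (- \<beta> t)" using that by (intro mult_left_mono) auto
      moreover have "r * \<beta> t \<le> e * \<beta> t" using that \<beta> by (intro mult_right_mono) auto
      ultimately show ?thesis by (simp add: mult.commute)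
    qed
    have "\<phi> t nL nH \<ge> \<phi> t 0 0 - 2 * \<beta> t * e"
      using tangent[of t nL nH] est[OF n(1,2) slope(1)] est[OF n(3,4) slope(2)] by simp
    moreover have "\<phi> t nL nH \<le> e"
      using u_ineq[of x] X(3)[of n] by (simp add: t_def nL_def nH_def x_def e_def)
    ultimately show ?thesis by (simp add: t_def e_def)
  qed
  have \<phi>_lim: "(\<lambda>n. \<phi> (u (X n)) a b) \<longlonglongrightarrow> \<phi> s a b" for a b
    using cont[of a b] lim by (auto simp: continuous_on_eq_continuous_at isCont_def intro: tendsto_compose isCont_tendsto_compose[of s "\<lambda>t. \<phi> t a b"])
  \<comment> \<open>Since \<open>\<beta>\<close> converges along the sequence, its product with
    \<open>inverse (Suc n)\<close> tends to 0.\<close>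
  have "(\<lambda>n. \<beta> (u (X n))) \<longlonglongrightarrow> \<beta> s"
    unfolding \<beta>_def by (intro tendsto_intros \<phi>_lim)
  from tendsto_diff[OF \<phi>_lim[of 0 0] tendsto_mult[OF tendsto_mult[OF tendsto_const[of 2] this] inv]]
  have "(\<lambda>n. \<phi> (u (X n)) 0 0 - 2 * \<beta> (u (X n)) * inverse (real (Suc n))) \<longlonglongrightarrow> \<phi> s 0 0" by simp
  from LIMSEQ_le[OF this inv] ineq show ?thesis by (auto simp: s_def)
qed

section \<open>Boundedness and the value at the supremum combined\<close>

theorem theorem5p1:
  fixes At :: "('a::{t2_space, second_countable_topology}, 'n::finite) chart set"
    and T10 :: "'a \<Rightarrow> (complex^'n) set"
    and \<theta> :: "'a \<Rightarrow> real^'n \<Rightarrow> real"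
    and nabla :: "('a, 'n) connection"
    and m :: nat
    and \<gamma> u :: "'a \<Rightarrow> real"
    and A B a :: real
    and G F f :: "real \<Rightarrow> real"
    and \<phi> :: "real \<Rightarrow> real \<Rightarrow> real \<Rightarrow> real"
  assumes M: "pseudo_hermitian_manifold At T10 \<theta> m"
    and nabla: "tanaka_webster At T10 \<theta> nabla"
    and gamma_C2: "Ck_fun At 2 \<gamma> UNIV"
    and gamma_nonneg: "\<And>x. \<gamma> x \<ge> 0"
    and A_pos: "A > 0" and B_pos: "B > 0"
    and G_smooth: "smooth_halfline G"
    and gamma_proper: "\<And>\<eta>. \<eta> > 0 \<Longrightarrow> \<exists>K. compact K \<and> (\<forall>x. x \<notin> K \<longrightarrow> \<gamma> x > \<eta>)"
    and gamma_gradient: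
      "\<exists>K. compact K \<and>
         (\<forall>x. x \<notin> K \<longrightarrow> webster_norm At T10 \<theta> x (gradient At T10 \<theta> \<gamma> x) \<le> A * sqrt (\<gamma> x))"
    and gamma_laplacian:
      "\<exists>K. compact K \<and>
         (\<forall>x. x \<notin> K \<longrightarrow> sub_laplacian At T10 \<theta> nabla \<gamma> x \<le> B * sqrt (\<gamma> x) * sqrt (G (sqrt (\<gamma> x))))"
    and G_0: "G 0 > 0"
    and G_mono: "\<And>t. t \<ge> 0 \<Longrightarrow> vector_derivative G (at t within {0..}) \<ge> 0"
    and G_not_L1: "\<not> (\<exists>c\<ge>0. set_integrable lborel {c..} (\<lambda>t. G t powr (-1/2)))"
    and G_limsup: "Limsup at_top (\<lambda>t. ereal (t * G (sqrt t) / G t)) < \<infinity>"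
    and u_C2: "Ck_fun At 2 u UNIV"
    and u_ineq:
      "\<And>x. sub_laplacian At T10 \<theta> nabla u x \<ge>
         \<phi> (u x) (webster_norm At T10 \<theta> x (gradientL At T10 \<theta> u x))
                 (webster_norm At T10 \<theta> x (gradientH At T10 \<theta> u x))"
    and phi_C0: "\<And>x1 x2. continuous_on UNIV (\<lambda>t. \<phi> t x1 x2)"
    and phi_C2: "\<And>t. Ck_on 2 (\<lambda>x :: real \<times> real. \<phi> t (fst x) (snd x)) UNIV"
    and phi_hess: "\<And>t x1 x2. positive_semidefinite (hessian2 (\<phi> t) x1 x2)"
    and f_eq: "\<And>t. f t = \<phi> t 0 0"
    and F_cont: "continuous_on UNIV F"
    and F_pos: "\<And>t. t \<ge> a \<Longrightarrow> F t > 0"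
    and F_int: "\<exists>b>a. set_integrable lborel {b..} (\<lambda>t. (integral {a..t} F) powr (-1/2))"
    and F_limsup: "Limsup at_top (\<lambda>t. ereal (integral {a..t} F / (t * F t))) < \<infinity>"
    and phi_liminf1:
      "Liminf at_top (\<lambda>t. ereal (sqrt (integral {a..t} F) / F t * partial1 (\<phi> t) 0 0)) > -\<infinity>"
    and phi_liminf2:
      "Liminf at_top (\<lambda>t. ereal (sqrt (integral {a..t} F) / F t * partial2 (\<phi> t) 0 0)) > -\<infinity>"
  shows "(Liminf at_top (\<lambda>t. ereal (f t / F t)) > 0 \<longrightarrow>
            bdd_above (range u) \<and> f (SUP x. u x) \<le> 0) \<and>
         (Liminf at_top (\<lambda>t. ereal (f t / F t)) \<le> 0 \<longrightarrow>
            (SUP x. ereal (u x)) = \<infinity> \<or> (bdd_above (range u) \<and> f (SUP x. u x) \<le> 0))"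
proof -
  interpret pseudo_hermitian At T10 \<theta> m by unfold_locales (rule M)
  note \<gamma> = Ck_fun_2_imp_twice_differentiable[OF gamma_C2]
  note u = Ck_fun_2_imp_twice_differentiable[OF u_C2]
  have proper: "\<forall>\<eta>>0. \<exists>K. compact K \<and> (\<forall>x. x \<notin> K \<longrightarrow> \<gamma> x > \<eta>)"
    and mono: "\<forall>t\<ge>0. vector_derivative G (at t within {0..}) \<ge> 0"
    using gamma_proper G_mono by blast+
  note OY = Omori_Yau_exhaustion[OF \<gamma> gamma_nonneg A_pos B_pos G_smooth proper gamma_gradient
      gamma_laplacian G_0 mono G_not_L1 G_limsup]
  note tangent = convex_tangent_plane[OF phi_C2 phi_hess]
  \<comment> \<open>The maximum principle applied to \<open>u\<close> itself; it serves both
    parts.\<close>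
  have sup: "f (SUP x. u x) \<le> 0" if "bdd_above (range u)"
    unfolding f_eq by (rule f_sup_nonpos[OF OY[OF u that] that u_ineq tangent phi_C0])
  have bdd: "bdd_above (range u)" if "Liminf at_top (\<lambda>t. ereal (f t / F t)) > 0"
    by (rule bounded_above[where u = u and \<phi> = \<phi> and F = F and a = a and nabla = nabla])
      (fact OY u u_ineq tangent F_cont F_pos F_int F_limsup phi_liminf1 phi_liminf2 that[unfolded f_eq])+
  \<comment> \<open>An unbounded \<open>u\<close> falls under the first alternative of part
    (2).\<close>
  have "(SUP x. ereal (u x)) = \<infinity>" if "\<not> bdd_above (range u)"
  proof (rule SUP_PInfty)
    fix n :: nat
    show "\<exists>x\<in>UNIV. ereal (real n) \<le> ereal (u x)"
      using that by (metis UNIV_I bdd_aboveI2 ereal_less_eq(3) linear)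
  qed
  then show ?thesis using sup bdd by (cases "bdd_above (range u)") auto
qed

end
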